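(* There exist absolute constants $c>0$ and $\varepsilon_0\in(0,1)$ such that the following holds. Let $0<\varepsilon<\varepsilon_0$, let $d\ge2$ be an integer, let $\mathcal{X},\mathcal{C}\subseteq\mathbb{R}^d$ be finite sets (with the Euclidean distance $\delta$), let $1\le k\le|\mathcal{C}|$, and let $\rho=32\cdot(2d)^{8d}\cdot\varepsilon^{-36d/\varepsilon}$. Let $\mathcal{S}\subseteq\mathcal{C}$ with $|\mathcal{S}|=k$ be locally optimal with respect to $\rho$-swaps, i.e. there are no $P\subseteq\mathcal{C}\setminus\mathcal{S}$, $Q\subseteq\mathcal{S}$ with $|P|=|Q|\le\rho$ and $\mathrm{cost}((\mathcal{S}\setminus Q)\cup P)<\mathrm{cost}(\mathcal{S})$, and let $\mathcal{O}\subseteq\mathcal{C}$ with $|\mathcal{O}|=k$ minimize $\mathrm{cost}$. Then $\mathrm{cost}(\mathcal{S})\le(1+c\,\varepsilon)\cdot\mathrm{cost}(\mathcal{O})$.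
   Context: For $S\subseteq\mathcal{C}$ and $j\in\mathcal{X}$, $\delta(j,S)=\min_{i\in S}\|j-i\|_2$, and $\mathrm{cost}(S)=\sum_{j\in\mathcal{X}}\delta(j,S)^2$ (the discrete $k$-means cost). *)

theory Defs
  imports "HOL-Analysis.Analysis"
begin

text \<open>
  The constants of the theorem must not depend on the dimension, so the dimension is a
  natural number and not a type: \<open>\<real>\<^sup>d\<close> is \<open>topspace (Euclidean_space d)\<close>, the functions
  \<open>nat \<Rightarrow> real\<close> that vanish at all indices \<open>i \<ge> d\<close>.
\<close>

definition eucl_dist :: "nat \<Rightarrow> (nat \<Rightarrow> real) \<Rightarrow> (nat \<Rightarrow> real) \<Rightarrow> real" where
  "eucl_dist d x y = L2_set (\<lambda>i. x i - y i) {..<d}"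

text \<open>Only meaningful for finite nonempty \<open>S\<close>, since \<open>Min\<close> is unspecified otherwise.\<close>

definition dist_to_centers :: "nat \<Rightarrow> (nat \<Rightarrow> real) \<Rightarrow> (nat \<Rightarrow> real) set \<Rightarrow> real" where
  "dist_to_centers d j S = Min ((\<lambda>i. eucl_dist d j i) ` S)"

definition kmeans_cost :: "nat \<Rightarrow> (nat \<Rightarrow> real) set \<Rightarrow> (nat \<Rightarrow> real) set \<Rightarrow> real" where
  "kmeans_cost d X S = (\<Sum>j\<in>X. (dist_to_centers d j S)\<^sup>2)"

definition swap_locally_optimal ::
  "nat \<Rightarrow> (nat \<Rightarrow> real) set \<Rightarrow> (nat \<Rightarrow> real) set \<Rightarrow> real \<Rightarrow> (nat \<Rightarrow> real) set \<Rightarrow> bool" where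
  "swap_locally_optimal d X C \<rho> S \<longleftrightarrow>
     \<not> (\<exists>P Q. P \<subseteq> C - S \<and> Q \<subseteq> S \<and> card P = card Q \<and> real (card Q) \<le> \<rho> \<and>
              kmeans_cost d X ((S - Q) \<union> P) < kmeans_cost d X S)"

definition swap_size :: "nat \<Rightarrow> real \<Rightarrow> real" where
  "swap_size d \<epsilon> = 32 * (2 * real d) ^ (8 * d) * \<epsilon> powr (- (36 * real d / \<epsilon>))"

end

theory Submission
  imports Defs
begin

text \<open>
  Let \<open>A = S - Opt\<close> and \<open>B = Opt - S\<close>. A partition of \<open>A \<union> B\<close> into balanced classes of
  bounded size gives one swap per class, none of which lowers the cost. If \<open>s \<in> A\<close> and \<open>t \<in> B\<close>
  are in the same class, then after each of these swaps \<open>s\<close> or \<open>t\<close> is open. If such a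
  pair lies within \<open>\<tau> * \<delta> a b\<close> of \<open>{a, b}\<close>, where \<open>a \<in> A\<close> and \<open>b \<in> B\<close> are the nearest centers
  of a client, then the total change of this client over all swaps is at most
  \<open>e\<^sup>2 - c\<^sup>2 + O(\<tau> + \<tau>\<^sup>2) * (c\<^sup>2 + e\<^sup>2)\<close>, where \<open>c\<close> and \<open>e\<close> are its distances to \<open>S\<close> and \<open>Opt\<close>.

  It remains to find a random partition for which \<open>\<tau> = 3\<close> always works and \<open>\<tau> = \<epsilon>\<close> works with
  probability \<open>1 - O(\<epsilon>)\<close>. Let \<open>D v\<close> be the distance of \<open>v\<close> to the opposite set. A net with
  covering radius \<open>2 * D v\<close> provides disjoint pairs (a net point and its nearest opposite center)
  which are never separated; they serve all \<open>a\<close>, \<open>b\<close> for which \<open>D a\<close> or \<open>D b\<close> is much smaller than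
  \<open>\<delta> a b\<close>. All other \<open>a\<close>, \<open>b\<close> are represented by points of a net with covering radius
  \<open>\<epsilon> * D v\<close>. The points of both nets are grouped into blocks according to a randomly shifted
  band of \<open>log (D v)\<close> and a randomly shifted grid at the scale of the band; a packing argument bounds
  the size of the blocks. Finally, blocks are merged into balanced classes: integers of modulus at
  most \<open>\<beta>\<close> with sum zero split into zero-sum groups of at most \<open>2 * \<beta> + 1\<close> members.
\<close>

subsection \<open>Euclidean distance and packing\<close>

lemma eucl_dist_nonneg [simp]: "0 \<le> eucl_dist d x y"
  by (simp add: eucl_dist_def)

lemma eucl_dist_commute: "eucl_dist d x y = eucl_dist d y x"
  by (simp add: eucl_dist_def L2_set_def power2_commute)

lemma eucl_dist_triangle: "eucl_dist d x z \<le> eucl_dist d x y + eucl_dist d y z"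
  using L2_set_triangle_ineq[of "\<lambda>i. x i - y i" "\<lambda>i. y i - z i" "{..<d}"]
  by (simp add: eucl_dist_def)

lemma eucl_dist_refl [simp]: "eucl_dist d x x = 0"
  by (simp add: eucl_dist_def L2_set_def)

lemma coordinate_le_eucl_dist:
  assumes "i < d"
  shows "\<bar>x i - y i\<bar> \<le> eucl_dist d x y"
  using member_le_L2_set[of "{..<d}" i "\<lambda>i. \<bar>x i - y i\<bar>"] assms
  by (simp add: eucl_dist_def L2_set_def)

lemma eucl_dist_le_coordinates:
  assumes "\<And>i. i < d \<Longrightarrow> \<bar>x i - y i\<bar> \<le> s"
  shows "eucl_dist d x y \<le> real d * s"
proof -
  have "eucl_dist d x y \<le> (\<Sum>i<d. \<bar>x i - y i\<bar>)"
    unfolding eucl_dist_def by (rule L2_set_le_sum_abs)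
  also have "\<dots> \<le> (\<Sum>i<d. s)"
    using assms by (intro sum_mono) auto
  finally show ?thesis by simp
qed

lemma eucl_dist_pos:
  assumes "x \<in> topspace (Euclidean_space d)" "y \<in> topspace (Euclidean_space d)" "x \<noteq> y"
  shows "0 < eucl_dist d x y"
proof -
  obtain i where i: "x i \<noteq> y i" using assms(3) by blast
  hence "i < d" using assms(1,2) by (auto simp: topspace_Euclidean_space) (metis not_le)
  from coordinate_le_eucl_dist[OF this, of x y] i show ?thesis by linarith
qed

text \<open>Rounding to a grid of side \<open>r / d\<close> is injective on \<open>F\<close>: two
  points with the same rounding are at distance at most \<open>r\<close>, because the Euclidean
  distance is at most the sum of the coordinate differences. It remains to count the grid cells that
  meet the box.\<close>

lemma card_separated_in_box:
  assumes "finite F" "0 < r" "0 < W" "0 < d"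
    and sep: "\<And>x y. x \<in> F \<Longrightarrow> y \<in> F \<Longrightarrow> x \<noteq> y \<Longrightarrow> r < eucl_dist d x y"
    and box: "\<And>x i. x \<in> F \<Longrightarrow> i < d \<Longrightarrow> p i \<le> x i \<and> x i \<le> p i + W"
  shows "real (card F) \<le> (W * real d / r + 2) ^ d"
proof -
  define s where "s = r / real d"
  have s: "0 < s" using assms by (simp add: s_def)
  define \<phi> where "\<phi> x = restrict (\<lambda>i. \<lfloor>x i / s\<rfloor>) {..<d}" for x :: "nat \<Rightarrow> real"
  have "inj_on \<phi> F"
  proof (rule inj_onI, rule ccontr)
    fix x y assume xy: "x \<in> F" "y \<in> F" "\<phi> x = \<phi> y" "x \<noteq> y"
    have "\<bar>x i - y i\<bar> \<le> s" if "i < d" for i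
    proof -
      have "\<lfloor>x i / s\<rfloor> = \<lfloor>y i / s\<rfloor>" using fun_cong[OF xy(3), of i] that by (simp add: \<phi>_def)
      then have "\<bar>x i / s - y i / s\<bar> \<le> 1" by linarith
      then have "\<bar>x i - y i\<bar> / s \<le> 1" using s by (simp add: diff_divide_distrib[symmetric] abs_divide)
      then show ?thesis using s by (simp add: field_simps)
    qed
    from eucl_dist_le_coordinates[of d x y s, OF this] have "eucl_dist d x y \<le> r"
      using assms(4) by (simp add: s_def)
    with sep[OF xy(1,2,4)] show False by simp
  qed
  define I where "I i = {\<lfloor>p i / s\<rfloor>..\<lfloor>(p i + W) / s\<rfloor>}" for i
  have "\<phi> ` F \<subseteq> PiE {..<d} I"
    unfolding \<phi>_def I_def using box s
    by (intro image_subsetI restrict_PiE_iff[THEN iffD2])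
      (auto intro!: floor_mono divide_right_mono)
  then have "card F \<le> card (PiE {..<d} I)"
    by (intro card_inj_on_le[OF \<open>inj_on \<phi> F\<close>]) (auto simp: I_def intro!: finite_PiE)
  also have "\<dots> = (\<Prod>i<d. card (I i))" by (simp add: card_PiE)
  finally have "real (card F) \<le> (\<Prod>i<d. real (card (I i)))" by (metis of_nat_le_iff of_nat_prod)
  also have "\<dots> \<le> (\<Prod>i<d. W / s + 2)"
  proof (rule prod_mono)
    fix i
    have "0 \<le> W / s" using s assms by simp
    moreover have "(p i + W) / s = p i / s + W / s" by (rule add_divide_distrib)
    ultimately have "real_of_int (\<lfloor>(p i + W) / s\<rfloor> - \<lfloor>p i / s\<rfloor> + 1) \<le> W / s + 2" by linarith
    then show "0 \<le> real (card (I i)) \<and> real (card (I i)) \<le> W / s + 2"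
      using \<open>0 \<le> W / s\<close> by (auto simp: I_def)
  qed
  also have "\<dots> = (W * real d / r + 2) ^ d" by (simp add: s_def)
  finally show ?thesis .
qed

subsection \<open>Nets, random shifts and zero-sum groups\<close>

text \<open>Points are visited in order of increasing \<open>w\<close>, and a point is kept iff it
  is not related by \<open>R\<close> to a point kept before. So of two kept points it is the heavier
  one that fails to be related to the lighter one.\<close>

lemma greedy_net:
  fixes w :: "'a \<Rightarrow> real"
  assumes "finite V" "\<And>v. R v v"
  shows "\<exists>E\<subseteq>V. (\<forall>v\<in>V. \<exists>u\<in>E. w u \<le> w v \<and> R v u) \<and>
    (\<forall>u\<in>E. \<forall>v\<in>E. u \<noteq> v \<longrightarrow> (w u \<le> w v \<and> \<not> R v u) \<or> (w v \<le> w u \<and> \<not> R u v))"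
  using assms(1)
proof (induction V rule: finite_ranking_induct[where f = w])
  case empty
  show ?case by simp
next
  case (insert x V)
  obtain E where E: "E \<subseteq> V" "\<forall>v\<in>V. \<exists>u\<in>E. w u \<le> w v \<and> R v u"
    "\<forall>u\<in>E. \<forall>v\<in>E. u \<noteq> v \<longrightarrow> (w u \<le> w v \<and> \<not> R v u) \<or> (w v \<le> w u \<and> \<not> R u v)"
    using insert.IH by (elim exE conjE) (rule that)
  show ?case
  proof (cases "\<exists>u\<in>E. R x u")
    case True
    then have "\<exists>u\<in>E. w u \<le> w x \<and> R x u"
      using insert.hyps(2) E(1) by blast
    then show ?thesis using E by (intro exI[of _ E]) blast
  next
    case False
    have "\<forall>v\<in>insert x V. \<exists>u\<in>insert x E. w u \<le> w v \<and> R v u"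
      using E(2) assms(2) by auto
    moreover have "w u \<le> w x \<and> \<not> R x u" if "u \<in> E" for u
      using that E(1) insert.hyps(2) False by blast
    ultimately show ?thesis
      using E(1,3) by (intro exI[of _ "insert x E"] conjI ballI impI) auto
  qed
qed

text \<open>This is Hermite's identity in integer form. Raising \<open>X\<close> by one telescopes
  the sum and changes it by exactly one, so induction in both directions from 0 suffices.\<close>

lemma sum_div_shift:
  fixes X :: int
  assumes "M > 0"
  shows "(\<Sum>q<M. (X + int q) div int M) = X"
proof -
  have step: "(\<Sum>q<M. (Y + 1 + int q) div int M) = (\<Sum>q<M. (Y + int q) div int M) + 1" for Y
  proof -
    let ?g = "\<lambda>q. (Y + int q) div int M"
    have "(\<Sum>q<M. (Y + 1 + int q) div int M) - (\<Sum>q<M. ?g q) = (\<Sum>q<M. ?g (Suc q) - ?g q)"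
      by (simp add: sum_subtractf algebra_simps)
    also have "\<dots> = ?g M - ?g 0" by (rule sum_lessThan_telescope)
    also have "\<dots> = 1" using assms by simp
    finally show ?thesis by simp
  qed
  have zero: "(\<Sum>q<M. (0 + int q) div int M) = 0"
    by (intro sum.neutral) auto
  show ?thesis
  proof (induction X rule: int_induct[where k = 0])
    case base
    show ?case using zero by simp
  next
    case (step1 i)
    then show ?case using step[of i] by simp
  next
    case (step2 i)
    then show ?case using step[of "i - 1"] by simp
  qed
qed

text \<open>A random shift by a multiple of \<open>1 / M\<close> separates two reals with
  probability at most their distance plus \<open>1 / M\<close>. After scaling by \<open>M\<close>
  the floors become integer divisions; every separating shift contributes at least one to the sum of
  their differences, and by Hermite's identity this sum equals the difference of the floors of
  \<open>M * y\<close> and \<open>M * x\<close>.\<close>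

lemma card_floor_shift:
  fixes x y :: real
  assumes "M > 0"
  shows "real (card {q. q < M \<and> \<lfloor>x + real q / real M\<rfloor> \<noteq> \<lfloor>y + real q / real M\<rfloor>})
    \<le> real M * \<bar>x - y\<bar> + 1"
proof -
  have fl: "\<lfloor>z + real q / real M\<rfloor> = (\<lfloor>real M * z\<rfloor> + int q) div int M" for z q
  proof -
    have "z + real q / real M = (real M * z + real q) / real_of_int (int M)"
      using assms by (simp add: field_simps)
    then have "\<lfloor>z + real q / real M\<rfloor> = \<lfloor>real M * z + real q\<rfloor> div int M"
      by (metis floor_divide_real_eq_div of_nat_0_le_iff)
    then show ?thesis by simp
  qed
  have main: "real (card {q. q < M \<and> \<lfloor>x + real q / real M\<rfloor> \<noteq> \<lfloor>y + real q / real M\<rfloor>})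
    \<le> real M * (y - x) + 1" if "x \<le> y" for x y :: real
  proof -
    define X Y where "X = \<lfloor>real M * x\<rfloor>" and "Y = \<lfloor>real M * y\<rfloor>"
    have XY: "X \<le> Y" unfolding X_def Y_def using that by (intro floor_mono mult_left_mono) auto
    have mono: "(X + int q) div int M \<le> (Y + int q) div int M" for q
      using XY assms by (intro zdiv_mono1) auto
    let ?Q = "{q. q < M \<and> \<lfloor>x + real q / real M\<rfloor> \<noteq> \<lfloor>y + real q / real M\<rfloor>}"
    have "int (card ?Q) = (\<Sum>q\<in>?Q. 1)" by simp
    also have "\<dots> \<le> (\<Sum>q\<in>?Q. (Y + int q) div int M - (X + int q) div int M)"
    proof (rule sum_mono)
      fix q assume "q \<in> ?Q"
      then have "(Y + int q) div int M \<noteq> (X + int q) div int M"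
        unfolding fl X_def Y_def by auto
      with mono[of q] show "1 \<le> (Y + int q) div int M - (X + int q) div int M" by linarith
    qed
    also have "\<dots> \<le> (\<Sum>q<M. (Y + int q) div int M - (X + int q) div int M)"
      using mono by (intro sum_mono2) auto
    also have "\<dots> = Y - X" using sum_div_shift[OF assms] by (simp add: sum_subtractf)
    finally have "real (card ?Q) \<le> real_of_int (Y - X)" by linarith
    also have "\<dots> \<le> real M * y - (real M * x - 1)" unfolding X_def Y_def by linarith
    finally show ?thesis by (simp add: algebra_simps)
  qed
  show ?thesis
  proof (cases "x \<le> y")
    case True
    then show ?thesis using main[OF True] by simp
  next
    case False
    have "{q. q < M \<and> \<lfloor>x + real q / real M\<rfloor> \<noteq> \<lfloor>y + real q / real M\<rfloor>} =
      {q. q < M \<and> \<lfloor>y + real q / real M\<rfloor> \<noteq> \<lfloor>x + real q / real M\<rfloor>}" by auto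
    then show ?thesis using main[of y x] False by simp
  qed
qed

text \<open>The members can be arranged so that all prefix sums stay in \<open>[-b, b]\<close>: a
  positive sum is followed by a nonpositive member, any other sum by a nonnegative one. Two of the
  first \<open>2 * b + 2\<close> prefixes then have equal sums, and their difference is the required
  set.\<close>

lemma small_zero_sum_subset:
  fixes z :: "'a \<Rightarrow> int"
  assumes "finite I" "I \<noteq> {}" and bd: "\<And>i. i \<in> I \<Longrightarrow> \<bar>z i\<bar> \<le> int b" and zero: "sum z I = 0"
  shows "\<exists>J\<subseteq>I. J \<noteq> {} \<and> card J \<le> 2 * b + 1 \<and> sum z J = 0"
proof (cases "card I \<le> 2 * b + 1")
  case True
  then show ?thesis using assms by blast
next
  case False
  \<comment> \<open>\<open>F n\<close> is the prefix of length \<open>n\<close> of the arrangement;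
    each step adds some member that keeps the prefix sum within the bound.\<close>
  define step where "step F = insert (SOME x. x \<in> I - F \<and> \<bar>sum z (insert x F)\<bar> \<le> int b) F" for F
  define F where "F n = (step ^^ n) {}" for n
  have step: "\<exists>x. x \<in> I - G \<and> \<bar>sum z (insert x G)\<bar> \<le> int b"
    if "G \<subseteq> I" "card G < card I" "\<bar>sum z G\<bar> \<le> int b" for G
  proof -
    have fG: "finite G" using that(1) assms(1) finite_subset by blast
    \<comment> \<open>The members not yet used sum to the negative of the prefix sum, so they cannot
      all have the wrong sign.\<close>
    have rest: "sum z (I - G) = - sum z G"
      using sum_diff[OF assms(1) that(1), of z] zero by simp
    have ne: "I - G \<noteq> {}" using that(1,2) by (metis Diff_eq_empty_iff less_irrefl subset_antisym)
    have "\<exists>x\<in>I - G. (0 < sum z G \<and> z x \<le> 0) \<or> (sum z G \<le> 0 \<and> z x \<ge> 0)"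
    proof (rule ccontr)
      assume c: "\<not> ?thesis"
      show False
      proof (cases "0 < sum z G")
        case True
        with c have "\<And>x. x \<in> I - G \<Longrightarrow> 0 < z x" by force
        then have "0 < sum z (I - G)" using ne assms(1) by (intro sum_pos) auto
        with rest True show False by simp
      next
        case False
        with c have "\<And>x. x \<in> I - G \<Longrightarrow> 0 < - z x" by force
        then have "0 < sum (\<lambda>x. - z x) (I - G)" using ne assms(1) by (intro sum_pos) auto
        with rest False show False by (simp add: sum_negf)
      qed
    qed
    then obtain x where x: "x \<in> I - G"
      "(0 < sum z G \<and> z x \<le> 0) \<or> (sum z G \<le> 0 \<and> z x \<ge> 0)" by blast
    have "sum z (insert x G) = z x + sum z G" using x(1) fG by simp
    moreover have "\<bar>z x\<bar> \<le> int b" using bd x(1) by blast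
    ultimately have "\<bar>sum z (insert x G)\<bar> \<le> int b" using x(2) that(3) by linarith
    with x(1) show ?thesis by blast
  qed
  have Fprop: "F n \<subseteq> I \<and> card (F n) = n \<and> \<bar>sum z (F n)\<bar> \<le> int b" if "n \<le> card I" for n
    using that
  proof (induction n)
    case 0
    show ?case by (simp add: F_def)
  next
    case (Suc n)
    then have IH: "F n \<subseteq> I" "card (F n) = n" "\<bar>sum z (F n)\<bar> \<le> int b" by auto
    define x where "x = (SOME x. x \<in> I - F n \<and> \<bar>sum z (insert x (F n))\<bar> \<le> int b)"
    have "card (F n) < card I" using IH(2) Suc.prems by simp
    from someI_ex[OF step[OF IH(1) this IH(3)]]
    have x: "x \<in> I - F n \<and> \<bar>sum z (insert x (F n))\<bar> \<le> int b"
      unfolding x_def .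
    have "F (Suc n) = insert x (F n)" by (simp add: F_def step_def x_def)
    moreover have "finite (F n)" using IH(1) assms(1) finite_subset by blast
    ultimately show ?case using x IH by auto
  qed
  have Fmono: "F k \<subseteq> F l" if "k \<le> l" for k l
    using that by (rule lift_Suc_mono_le[rotated]) (auto simp: F_def step_def)
  \<comment> \<open>The indices from 0 to \<open>2 * b + 1\<close> give \<open>2 * b + 2\<close>
    prefixes, one more than there are integers in \<open>[-b, b]\<close>. All of them exist since
    \<open>card I\<close> exceeds \<open>2 * b + 1\<close>.\<close>
  have "\<not> inj_on (\<lambda>n. sum z (F n)) {..2 * b + 1}"
  proof (rule pigeonhole)
    have "(\<lambda>n. sum z (F n)) ` {..2 * b + 1} \<subseteq> {- int b..int b}"
    proof (rule image_subsetI)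
      fix n assume "n \<in> {..2 * b + 1}"
      then have "n \<le> card I" using False by simp
      then show "sum z (F n) \<in> {- int b..int b}" using Fprop[of n] by (simp add: abs_le_iff)
    qed
    then have "card ((\<lambda>n. sum z (F n)) ` {..2 * b + 1}) \<le> card {- int b..int b}"
      by (intro card_mono) auto
    then show "card ((\<lambda>n. sum z (F n)) ` {..2 * b + 1}) < card {..2 * b + 1}" by simp
  qed
  then obtain k l where "k < l" and l: "l \<le> 2 * b + 1" and eq: "sum z (F k) = sum z (F l)"
    unfolding inj_on_def by (metis atMost_iff linorder_neqE_nat)
  have kl: "k \<le> card I" "l \<le> card I" using \<open>k < l\<close> l False by auto
  have sub: "F k \<subseteq> F l" using Fmono \<open>k < l\<close> by simp
  have fin: "finite (F l)" using Fprop[OF kl(2)] assms(1) finite_subset by blast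
  have "card (F l - F k) = l - k"
    using Fprop[OF kl(1)] Fprop[OF kl(2)] card_Diff_subset[OF finite_subset[OF sub fin] sub] by simp
  moreover have "sum z (F l - F k) = 0"
    using sum_diff[OF fin sub, of z] eq by simp
  moreover have "F l - F k \<noteq> {}"
    using \<open>k < l\<close> calculation(1) by (metis card.empty less_irrefl zero_less_diff)
  moreover have "F l - F k \<subseteq> I" using Fprop[OF kl(2)] by blast
  ultimately show ?thesis using l by (intro exI[of _ "F l - F k"]) simp
qed

text \<open>Removing a small zero-sum subset leaves a zero-sum family with the same bound, so the
  splitting can be repeated until nothing is left.\<close>

lemma zero_sum_grouping:
  fixes z :: "'a \<Rightarrow> int"
  assumes "finite I" "\<And>i. i \<in> I \<Longrightarrow> \<bar>z i\<bar> \<le> int b" "sum z I = 0"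
  shows "\<exists>g :: 'a \<Rightarrow> nat. \<forall>n. card {i\<in>I. g i = n} \<le> 2 * b + 1 \<and> sum z {i\<in>I. g i = n} = 0"
  using assms
proof (induction I rule: finite_psubset_induct)
  case (psubset I)
  show ?case
  proof (cases "I = {}")
    case True
    then show ?thesis by simp
  next
    case False
    from small_zero_sum_subset[OF psubset.hyps(1) False psubset.prems]
    obtain J where J: "J \<subseteq> I" "J \<noteq> {}" "card J \<le> 2 * b + 1" "sum z J = 0" by blast
    have "sum z (I - J) = 0"
      using J sum_diff[OF psubset.hyps(1) J(1), of z] psubset.prems(2) by simp
    moreover have "I - J \<subset> I" using J by blast
    ultimately obtain g :: "'a \<Rightarrow> nat" where
      g: "\<And>n. card {i\<in>I - J. g i = n} \<le> 2 * b + 1 \<and> sum z {i\<in>I - J. g i = n} = 0"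
      using psubset.IH[of "I - J"] psubset.prems(1) by blast
    \<comment> \<open>The removed subset takes the label 0, and the labels of the remaining groups
      move up by one.\<close>
    define g' where "g' i = (if i \<in> J then 0 else Suc (g i))" for i
    have "{i\<in>I. g' i = 0} = J" using J by (auto simp: g'_def)
    moreover have "{i\<in>I. g' i = Suc n} = {i\<in>I - J. g i = n}" for n by (auto simp: g'_def)
    ultimately have "card {i\<in>I. g' i = n} \<le> 2 * b + 1 \<and> sum z {i\<in>I. g' i = n} = 0" for n
      using J g by (cases n) auto
    then show ?thesis by blast
  qed
qed

lemma card_vimage_sum:
  assumes "finite A" "finite J"
  shows "card {a\<in>A. f a \<in> J} = (\<Sum>x\<in>J. card {a\<in>A. f a = x})"
proof -
  have "{a\<in>A. f a \<in> J} = (\<Union>x\<in>J. {a\<in>A. f a = x})" by auto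
  then show ?thesis using assms by (simp only:) (subst card_UN_disjoint, auto)
qed

text \<open>The surplus of \<open>A\<close> over \<open>B\<close> in each block is an integer of
  modulus at most \<beta>, and the surpluses sum to zero. Zero-sum grouping merges at most
  \<open>2 * \<beta> + 1\<close> blocks into one class, each with at most \<beta> points.\<close>

lemma balanced_coarsening:
  fixes f :: "'a \<Rightarrow> 'b"
  assumes "finite A" "finite B" "card A = card B"
    and small: "\<And>x. card {v\<in>A \<union> B. f v = x} \<le> \<beta>"
  shows "\<exists>g :: 'b \<Rightarrow> nat. \<forall>n. card {a\<in>A. g (f a) = n} = card {b\<in>B. g (f b) = n} \<and>
    card {b\<in>B. g (f b) = n} \<le> (2 * \<beta> + 1) * \<beta>"
proof -
  define I where "I = f ` (A \<union> B)"
  define z where "z x = int (card {a\<in>A. f a = x}) - int (card {b\<in>B. f b = x})" for x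
  have fin: "finite I" using assms by (simp add: I_def)
  have smallA: "card {a\<in>A. f a = x} \<le> \<beta>" and smallB: "card {b\<in>B. f b = x} \<le> \<beta>" for x
    using small[of x] card_mono[of "{v\<in>A \<union> B. f v = x}" "{a\<in>A. f a = x}"]
      card_mono[of "{v\<in>A \<union> B. f v = x}" "{b\<in>B. f b = x}"] assms(1,2) by fastforce+
  have sumz: "sum z J = int (card {a\<in>A. f a \<in> J}) - int (card {b\<in>B. f b \<in> J})"
    if "finite J" for J
    using card_vimage_sum[OF assms(1) that, of f] card_vimage_sum[OF assms(2) that, of f]
    by (simp add: z_def sum_subtractf)
  have "\<bar>z x\<bar> \<le> int \<beta>" for x
    using smallA[of x] smallB[of x] by (simp add: z_def)
  moreover have "{a\<in>A. f a \<in> I} = A" "{b\<in>B. f b \<in> I} = B" by (auto simp: I_def)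
  then have "sum z I = 0" using sumz[OF fin] assms(3) by simp
  ultimately obtain g :: "'b \<Rightarrow> nat" where
    g: "\<And>n. card {i\<in>I. g i = n} \<le> 2 * \<beta> + 1 \<and> sum z {i\<in>I. g i = n} = 0"
    using zero_sum_grouping[OF fin, of z \<beta>] by blast
  have "card {a\<in>A. g (f a) = n} = card {b\<in>B. g (f b) = n} \<and>
    card {b\<in>B. g (f b) = n} \<le> (2 * \<beta> + 1) * \<beta>" for n
  proof -
    define J where "J = {i\<in>I. g i = n}"
    have finJ: "finite J" using fin by (simp add: J_def)
    have eqs: "{a\<in>A. g (f a) = n} = {a\<in>A. f a \<in> J}" "{b\<in>B. g (f b) = n} = {b\<in>B. f b \<in> J}"
      by (auto simp: J_def I_def)
    have "card {b\<in>B. f b \<in> J} \<le> (\<Sum>x\<in>J. \<beta>)"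
      unfolding card_vimage_sum[OF assms(2) finJ] using smallB by (intro sum_mono) auto
    also have "\<dots> = card J * \<beta>" by simp
    also have "\<dots> \<le> (2 * \<beta> + 1) * \<beta>" using g[of n] unfolding J_def by (intro mult_right_mono) auto
    finally show ?thesis using sumz[OF finJ] g[of n] eqs by (simp add: J_def)
  qed
  then show ?thesis by blast
qed

subsection \<open>Blocks\<close>

text \<open>Each of \<open>s\<close> and \<open>t\<close> may choose separately which of
  \<open>a\<close> and \<open>b\<close> it is near. This admits both a pair lying near a single
  center and a pair of representatives, one for each center.\<close>

definition linked where
  "linked d A B f \<tau> a b \<longleftrightarrow> (\<exists>s\<in>A. \<exists>t\<in>B. f s = f t \<and>
    (\<forall>v\<in>{s, t}. eucl_dist d v a \<le> \<tau> * eucl_dist d a b \<or> eucl_dist d v b \<le> \<tau> * eucl_dist d a b))"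

locale two_center_sets =
  fixes d :: nat and A B :: "(nat \<Rightarrow> real) set" and \<epsilon> :: real
  assumes finite_A: "finite A" and finite_B: "finite B" and card_eq: "card A = card B"
    and disjoint: "A \<inter> B = {}"
    and in_space: "A \<union> B \<subseteq> topspace (Euclidean_space d)"
    and dim: "2 \<le> d" and eps_pos: "0 < \<epsilon>" and eps_small: "\<epsilon> \<le> 1 / 42"
begin

abbreviation \<delta> where "\<delta> \<equiv> eucl_dist d"

abbreviation "V \<equiv> A \<union> B"

definition other where "other v = (if v \<in> A then B else A)"

definition D where "D v = dist_to_centers d v (other v)"

definition nb where "nb v = (SOME w. w \<in> other v \<and> \<delta> v w = D v)"

lemma finite_V [simp]: "finite V"
  using finite_A finite_B by simp

lemma other_finite_nonempty:
  assumes "v \<in> V"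
  shows "finite (other v)" "other v \<noteq> {}"
  using assms finite_A finite_B card_eq card_gt_0_iff[of A] card_gt_0_iff[of B]
  by (auto simp: other_def)

lemma D_le: "v \<in> V \<Longrightarrow> w \<in> other v \<Longrightarrow> D v \<le> \<delta> v w"
  using other_finite_nonempty[of v] by (auto simp: D_def dist_to_centers_def)

lemma nb:
  assumes "v \<in> V"
  shows nb_other: "nb v \<in> other v" and nb_dist: "\<delta> v (nb v) = D v"
proof -
  have "D v \<in> \<delta> v ` other v"
    unfolding D_def dist_to_centers_def
    using other_finite_nonempty[OF assms] by (intro Min_in) auto
  then have "\<exists>w. w \<in> other v \<and> \<delta> v w = D v" by auto
  from someI_ex[OF this] show "nb v \<in> other v" "\<delta> v (nb v) = D v"
    by (auto simp: nb_def)
qed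

lemma other_subset: "other v \<subseteq> V"
  by (auto simp: other_def)

lemma nb_in_V: "v \<in> V \<Longrightarrow> nb v \<in> V"
  using nb_other other_subset by blast

lemma other_sym: "v \<in> V \<Longrightarrow> w \<in> other v \<Longrightarrow> v \<in> other w"
  using disjoint by (auto simp: other_def split: if_splits)

lemma other_eqI: "v \<in> V \<Longrightarrow> u \<in> V \<Longrightarrow> u \<notin> other v \<Longrightarrow> other u = other v"
  using disjoint by (auto simp: other_def split: if_splits)

lemma nb_neq: "v \<in> V \<Longrightarrow> nb v \<noteq> v"
  using nb_other[of v] disjoint by (auto simp: other_def split: if_splits)

lemma D_nb_le: "v \<in> V \<Longrightarrow> D (nb v) \<le> D v"
  using D_le[of "nb v" v] nb_in_V[of v] other_sym[OF _ nb_other] nb_dist[of v]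
  by (simp add: eucl_dist_commute)

lemma D_pos:
  assumes "v \<in> V"
  shows "0 < D v"
  using nb_dist[OF assms] eucl_dist_pos[of v d "nb v"] nb_neq[OF assms] nb_in_V[OF assms]
    assms in_space by auto

lemma D_lipschitz:
  assumes "u \<in> V" "v \<in> V" "other u = other v"
  shows "D u \<le> \<delta> u v + D v"
proof -
  have "D u \<le> \<delta> u (nb v)" using D_le[of u "nb v"] nb_other[of v] assms by simp
  also have "\<dots> \<le> \<delta> u v + \<delta> v (nb v)" by (rule eucl_dist_triangle)
  finally show ?thesis using nb_dist assms by simp
qed

section \<open>Nets at the scale of \<open>D\<close>, and pairs of roots with their nearest opposite
  centers\<close>

definition is_net where
  "is_net \<kappa> E \<longleftrightarrow> E \<subseteq> V \<and> (\<forall>v\<in>V. \<exists>u\<in>E. D u \<le> D v \<and> \<delta> v u \<le> \<kappa> * D v) \<and>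
    (\<forall>u\<in>E. \<forall>v\<in>E. u \<noteq> v \<longrightarrow> \<kappa> * D u < \<delta> u v \<and> \<kappa> * D v < \<delta> u v)"

definition net where "net \<kappa> = (SOME E. is_net \<kappa> E)"

text \<open>The greedy net for the weight \<open>D\<close> works: the failing relation gives
  separation at the scale of the point with the larger \<open>D\<close>, which also covers the scale
  of the other point.\<close>

lemma is_net_net:
  assumes "0 \<le> \<kappa>"
  shows "is_net \<kappa> (net \<kappa>)"
proof -
  \<comment> \<open>The disjunct \<open>v = u\<close> makes the relation reflexive also outside
    \<open>V\<close>, where the sign of \<open>D\<close> is not known.\<close>
  let ?R = "\<lambda>v u. v = u \<or> \<delta> v u \<le> \<kappa> * D v"
  obtain E where E: "E \<subseteq> V" "\<forall>v\<in>V. \<exists>u\<in>E. D u \<le> D v \<and> ?R v u"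
    "\<forall>u\<in>E. \<forall>v\<in>E. u \<noteq> v \<longrightarrow> (D u \<le> D v \<and> \<not> ?R v u) \<or> (D v \<le> D u \<and> \<not> ?R u v)"
    using greedy_net[OF finite_V, of ?R D, OF disjI1[OF refl]] by (elim exE conjE) (rule that)
  have "\<forall>v\<in>V. \<exists>u\<in>E. D u \<le> D v \<and> \<delta> v u \<le> \<kappa> * D v"
  proof
    fix v assume v: "v \<in> V"
    then obtain u where u: "u \<in> E" "D u \<le> D v" "?R v u" using E(2) by blast
    have "0 \<le> \<kappa> * D v" using assms D_pos[OF v] by simp
    then show "\<exists>u\<in>E. D u \<le> D v \<and> \<delta> v u \<le> \<kappa> * D v" using u by auto
  qed
  moreover have "\<kappa> * D u < \<delta> u v \<and> \<kappa> * D v < \<delta> u v" if "u \<in> E" "v \<in> E" "u \<noteq> v" for u v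
  proof -
    have "D u \<le> D v \<Longrightarrow> \<kappa> * D u \<le> \<kappa> * D v" "D v \<le> D u \<Longrightarrow> \<kappa> * D v \<le> \<kappa> * D u"
      using assms by (auto intro: mult_left_mono)
    moreover have "\<delta> u v = \<delta> v u" by (rule eucl_dist_commute)
    moreover have "(D u \<le> D v \<and> \<not> ?R v u) \<or> (D v \<le> D u \<and> \<not> ?R u v)"
      using E(3) that by blast
    ultimately show ?thesis by linarith
  qed
  ultimately have "is_net \<kappa> E" using E(1) unfolding is_net_def by blast
  then show ?thesis unfolding net_def by (rule someI)
qed

lemma net_subset: "0 \<le> \<kappa> \<Longrightarrow> net \<kappa> \<subseteq> V"
  using is_net_net by (auto simp: is_net_def)

lemma net_cover:
  assumes "0 \<le> \<kappa>" "v \<in> V"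
  obtains u where "u \<in> net \<kappa>" "D u \<le> D v" "\<delta> v u \<le> \<kappa> * D v"
proof -
  have "\<forall>v\<in>V. \<exists>u\<in>net \<kappa>. D u \<le> D v \<and> \<delta> v u \<le> \<kappa> * D v"
    using is_net_net[OF assms(1)] by (simp add: is_net_def)
  with assms(2) that show ?thesis by blast
qed

lemma net_separated:
  assumes "0 \<le> \<kappa>" "u \<in> net \<kappa>" "v \<in> net \<kappa>" "u \<noteq> v"
  shows "\<kappa> * D u < \<delta> u v" "\<kappa> * D v < \<delta> u v"
  using is_net_net[OF assms(1)] assms(2-) by (simp_all add: is_net_def)

lemma roots_in_V: "u \<in> net 2 \<Longrightarrow> u \<in> V"
  using net_subset[of 2] by auto

text \<open>Covering radius 2 makes the pairs disjoint: \<open>nb u\<close> is only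
  \<open>D u\<close> away from \<open>u\<close>, and a common partner would bring two roots within
  \<open>D u + D v\<close>, while their distance exceeds both \<open>2 * D u\<close> and
  \<open>2 * D v\<close>.\<close>

lemma roots_nb_distinct:
  assumes "u \<in> net 2" "v \<in> net 2" "u \<noteq> v"
  shows "nb u \<noteq> v" "nb u \<noteq> nb v"
proof -
  note sep = net_separated[OF _ assms, simplified]
  have pos: "0 < D u" "0 < D v" using assms roots_in_V D_pos by auto
  have nbs: "\<delta> u (nb u) = D u" "\<delta> v (nb v) = D v" using assms roots_in_V nb_dist by auto
  show "nb u \<noteq> v" using nbs(1) sep(1) pos by auto
  show "nb u \<noteq> nb v"
  proof
    assume "nb u = nb v"
    then have "\<delta> u v \<le> D u + D v"
      using eucl_dist_triangle[of d u v "nb u"] nbs by (simp add: eucl_dist_commute)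
    with sep show False by linarith
  qed
qed

text \<open>A root and its partner live on the same scale. If \<open>D (nb u)\<close> were below
  \<open>D u / 2\<close>, the root covering \<open>nb u\<close> would differ from \<open>u\<close>
  and yet be closer to \<open>u\<close> than the separation allows.\<close>

lemma D_root_le:
  assumes "u \<in> net 2"
  shows "D u \<le> 2 * D (nb u)"
proof (rule ccontr)
  assume less: "\<not> ?thesis"
  have u: "u \<in> V" using assms roots_in_V by blast
  obtain x where x: "x \<in> net 2" "D x \<le> D (nb u)" "\<delta> (nb u) x \<le> 2 * D (nb u)"
    using net_cover[of 2 "nb u"] nb_in_V[OF u] by auto
  have "x \<noteq> u" using less x(2) D_pos[OF nb_in_V[OF u]] by auto
  with net_separated(2)[of 2 x u] x(1) assms have "2 * D u < \<delta> x u" by simp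
  also have "\<dots> \<le> \<delta> u (nb u) + \<delta> (nb u) x"
    using eucl_dist_triangle[of d u x "nb u"] by (simp add: eucl_dist_commute)
  also have "\<dots> \<le> D u + 2 * D (nb u)" using x(3) nb_dist[OF u] by simp
  finally show False using less by linarith
qed

text \<open>
  A paired point takes part in the banding and the grid through the net point of its pair, so that
  pairs are never separated.
\<close>

definition anc where
  "anc v = (if \<exists>u\<in>net 2. v = nb u then (THE u. u \<in> net 2 \<and> v = nb u) else v)"

lemma anc_nb:
  assumes "u \<in> net 2"
  shows "anc (nb u) = u"
proof -
  have "(THE x. x \<in> net 2 \<and> nb u = nb x) = u"
    using assms roots_nb_distinct(2) by (intro the_equality) auto
  then show ?thesis using assms by (auto simp: anc_def)
qed

lemma anc_root:
  assumes "u \<in> net 2"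
  shows "anc u = u"
proof -
  have "\<not> (\<exists>x\<in>net 2. u = nb x)"
    using assms roots_nb_distinct(1) nb_neq roots_in_V by metis
  then show ?thesis by (simp add: anc_def)
qed

lemma anc_cases:
  obtains (root) u where "u \<in> net 2" "v = nb u" "anc v = u" | (self) "anc v = v"
proof (cases "\<exists>u\<in>net 2. v = nb u")
  case True
  then show ?thesis using root anc_nb by blast
next
  case False
  then show ?thesis using self by (simp add: anc_def)
qed

text \<open>Passing to the ancestor costs only a factor 2 in scale and a move of comparable length;
  the nontrivial case is the partner of a root.\<close>

lemma anc_bounds:
  assumes "v \<in> V"
  shows "anc v \<in> V" "D v \<le> D (anc v)" "D (anc v) \<le> 2 * D v" "\<delta> v (anc v) \<le> 2 * D v"
proof -
  have "anc v \<in> V \<and> D v \<le> D (anc v) \<and> D (anc v) \<le> 2 * D v \<and> \<delta> v (anc v) \<le> 2 * D v"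
  proof (cases v rule: anc_cases)
    case (root u)
    have u: "u \<in> V" using root(1) roots_in_V by blast
    have "\<delta> v u = D u" using nb_dist[OF u] root(2) by (simp add: eucl_dist_commute)
    then show ?thesis using u root D_nb_le[OF u] D_root_le[OF root(1)] by simp
  next
    case self
    then show ?thesis using assms D_pos[OF assms] by simp
  qed
  then show "anc v \<in> V" "D v \<le> D (anc v)" "D (anc v) \<le> 2 * D v" "\<delta> v (anc v) \<le> 2 * D v"
    by auto
qed

section \<open>Shifted bands of \<open>log L (D v)\<close> and shifted grids\<close>

definition L where "L = 1 / \<epsilon>"

text \<open>\<open>m\<close> is the number of band shifts and also the logarithmic length of a band,
  \<open>M\<close> the number of grid shifts. The bounds \<open>m \<ge> L\<close> and
  \<open>M \<ge> d * L\<close> make the rounding losses of the discrete shifts of order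
  \<epsilon>.\<close>

definition m where "m = nat \<lceil>1 / \<epsilon>\<rceil>"

definition M where "M = nat \<lceil>real d / \<epsilon>\<rceil>"

lemma L_ge: "42 \<le> L"
  using eps_pos eps_small by (simp add: L_def field_simps)

lemma m_bounds: "0 < m" "L \<le> real m" "real m \<le> L + 1"
proof -
  show "L \<le> real m" unfolding m_def L_def by (rule real_nat_ceiling_ge)
  with L_ge show "0 < m" by simp
  show "real m \<le> L + 1" unfolding m_def L_def using eps_pos by simp
qed

lemma M_bounds: "0 < M" "real d * L \<le> real M"
proof -
  show "real d * L \<le> real M" unfolding M_def L_def
    using real_nat_ceiling_ge[of "real d / \<epsilon>"] by simp
  moreover have "0 < real d * L" using dim L_ge by simp
  ultimately show "0 < M" by simp
qed

text \<open>Band \<open>k\<close> consists of the points with \<open>D v\<close> between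
  \<open>L powr (m * k - h)\<close> and \<open>L ^ m\<close> times this value.\<close>

definition band where "band h v = \<lfloor>log L (D v) / real m + real h / real m\<rfloor>"

text \<open>The last factor is the upper end of \<open>D\<close> on band \<open>k\<close>. The
  factor \<open>d * L ^ 3\<close> makes distances up to \<open>L ^ 2\<close> times this upper end a
  fraction \<open>1 / (d * L)\<close> of the cell width, small enough for a union bound over
  \<open>d\<close> coordinates.\<close>

definition width :: "nat \<Rightarrow> int \<Rightarrow> real" where
  "width h k = real d * L ^ 3 * L powr (real m * (real_of_int k + 1) - real h)"

text \<open>
  The same shift is used for all coordinates: the union bound over coordinates needs no
  independence.
\<close>

definition cell where
  "cell h q v = (\<lambda>i. if i < d then \<lfloor>v i / width h (band h v) + real q / real M\<rfloor> else 0)"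

definition essential where "essential = net \<epsilon> \<union> net 2 \<union> nb ` net 2"

text \<open>Only net points and partners of roots ever serve as links. All other points form
  singleton blocks, so that packing arguments for nets bound every block.\<close>

definition block :: "nat \<Rightarrow> nat \<Rightarrow> (nat \<Rightarrow> real) \<Rightarrow> (int \<times> (nat \<Rightarrow> int)) + (nat \<Rightarrow> real)" where
  "block h q v = (if v \<in> essential then Inl (band h (anc v), cell h q (anc v)) else Inr v)"

lemma width_pos: "0 < width h k"
  using dim L_ge by (simp add: width_def)

lemma band_bounds:
  assumes "v \<in> V" "band h v = k"
  shows "L powr (real m * real_of_int k - real h) \<le> D v"
    and "D v < L powr (real m * (real_of_int k + 1) - real h)"
proof -
  have L1: "1 < L" using L_ge by simp
  have m: "0 < real m" using m_bounds by simp
  have D: "D v = L powr log L (D v)" using D_pos[OF assms(1)] L1 by simp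
  have "real_of_int k \<le> (log L (D v) + real h) / real m"
    "(log L (D v) + real h) / real m < real_of_int k + 1"
    using assms(2) unfolding band_def add_divide_distrib by linarith+
  then have "real m * real_of_int k - real h \<le> log L (D v)"
    "log L (D v) < real m * (real_of_int k + 1) - real h"
    using m by (auto simp: field_simps)
  then show "L powr (real m * real_of_int k - real h) \<le> D v"
    "D v < L powr (real m * (real_of_int k + 1) - real h)"
    using L1 by (subst D, simp)+
qed

section \<open>Packing bound for blocks and the resulting swap size\<close>

definition cell_bound :: real where
  "cell_bound = ((real d)\<^sup>2 * L ^ (m + 4) + 2) ^ d"

text \<open>With \<open>r\<close> the lower end of the band, the points are more than
  \<open>\<epsilon> * r\<close> apart and lie in a cube whose side is the cell width. In the base of
  \<open>cell_bound\<close>, one \<open>d\<close> and \<open>L ^ 3\<close> come from the width,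
  \<open>L ^ m\<close> from the ratio of the band ends, \<open>L\<close> from the separation, and
  the other \<open>d\<close> from packing.\<close>

lemma card_net_cell:
  assumes "\<epsilon> \<le> \<kappa>"
  shows "real (card {v \<in> net \<kappa>. band h v = k \<and> cell h q v = c}) \<le> cell_bound" (is "real (card ?F) \<le> _")
proof -
  define r where "r = L powr (real m * real_of_int k - real h)"
  define W where "W = width h k"
  have r: "0 < r" using L_ge by (simp add: r_def)
  have kap: "0 \<le> \<kappa>" using assms eps_pos by simp
  have FV: "?F \<subseteq> V" using net_subset[OF kap] by blast
  have W: "0 < W" unfolding W_def by (rule width_pos)
  have "real (card ?F) \<le> (W * real d / (\<epsilon> * r) + 2) ^ d"
  proof (rule card_separated_in_box)
    show "finite ?F" using FV finite_V finite_subset by blast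
    show "0 < \<epsilon> * r" using r eps_pos by simp
    show "0 < W" by (rule W)
    show "0 < d" using dim by simp
  next
    fix x y assume xy: "x \<in> ?F" "y \<in> ?F" "x \<noteq> y"
    have "r \<le> D x" using band_bounds(1)[of x h k] xy FV by (auto simp: r_def)
    then have "\<epsilon> * r \<le> \<kappa> * D x" using assms r eps_pos by (intro mult_mono) auto
    also have "\<dots> < \<delta> x y" using net_separated(1)[OF kap] xy by auto
    finally show "\<epsilon> * r < \<delta> x y" .
  next
    fix x i assume x: "x \<in> ?F" "i < d"
    have "\<lfloor>x i / W + real q / real M\<rfloor> = c i"
      using x by (auto simp: cell_def W_def)
    then have "real_of_int (c i) - real q / real M \<le> x i / W"
      "x i / W \<le> real_of_int (c i) - real q / real M + 1" by linarith+
    then have "W * (real_of_int (c i) - real q / real M) \<le> x i"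
      "x i \<le> W * (real_of_int (c i) - real q / real M + 1)"
      using W by (simp_all only: pos_le_divide_eq pos_divide_le_eq mult.commute)
    then show "W * (real_of_int (c i) - real q / real M) \<le> x i \<and>
      x i \<le> W * (real_of_int (c i) - real q / real M) + W"
      by (simp add: algebra_simps)
  qed
  also have "W * real d / (\<epsilon> * r) = (real d)\<^sup>2 * L ^ (m + 4)"
  proof -
    have "L powr (real m * (real_of_int k + 1) - real h) = r * L ^ m"
      using L_ge by (simp add: r_def powr_add[symmetric] powr_realpow[symmetric] algebra_simps)
    then have "W = real d * L ^ 3 * (r * L ^ m)" by (simp add: W_def width_def)
    moreover have "1 / \<epsilon> = L" by (simp add: L_def)
    ultimately have "W * real d / (\<epsilon> * r) = real d * L ^ 3 * L ^ m * real d * L"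
      using r eps_pos by (simp add: field_simps)
    also have "\<dots> = (real d)\<^sup>2 * L ^ (m + 4)"
      by (simp add: power_add power2_eq_square power3_eq_cube power4_eq_xxxx)
    finally show ?thesis .
  qed
  finally show ?thesis by (simp add: cell_bound_def)
qed

lemma cell_bound_ge_1: "1 \<le> cell_bound"
  unfolding cell_bound_def using L_ge by (intro one_le_power) (simp add: add_increasing)

text \<open>A shared block consists of points of the fine net, roots, and partners of roots in one
  band and cell. Partners are counted by their roots, so three times the packing bound would
  suffice.\<close>

lemma card_block: "real (card {v\<in>V. block h q v = x}) \<le> 4 * cell_bound"
proof (cases x)
  case (Inr y)
  then have "{v\<in>V. block h q v = x} \<subseteq> {y}" by (auto simp: block_def split: if_splits)
  then have "card {v\<in>V. block h q v = x} \<le> 1"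
    using card_mono[of "{y}"] by fastforce
  then show ?thesis using cell_bound_ge_1 by linarith
next
  case (Inl kc)
  obtain k c where kc: "kc = (k, c)" by fastforce
  define G where "G \<kappa> = {v \<in> net \<kappa>. band h v = k \<and> cell h q v = c}" for \<kappa>
  have fin: "finite (G \<epsilon>)" "finite (G 2)"
    using net_subset[of \<epsilon>] net_subset[of 2] eps_pos unfolding G_def
    by (auto intro!: finite_subset[OF _ finite_V])
  have "{v\<in>V. block h q v = x} \<subseteq> G \<epsilon> \<union> G 2 \<union> nb ` G 2"
  proof
    fix v assume "v \<in> {v\<in>V. block h q v = x}"
    then have v: "v \<in> essential" "band h (anc v) = k" "cell h q (anc v) = c"
      using Inl kc by (auto simp: block_def split: if_splits)
    show "v \<in> G \<epsilon> \<union> G 2 \<union> nb ` G 2"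
    proof (cases v rule: anc_cases)
      case (root u)
      then show ?thesis using v by (auto simp: G_def)
    next
      case self
      have "v \<notin> nb ` net 2"
        using self anc_nb nb_neq roots_in_V by (metis imageE)
      then show ?thesis using v self by (auto simp: G_def essential_def)
    qed
  qed
  then have "card {v\<in>V. block h q v = x} \<le> card (G \<epsilon> \<union> G 2 \<union> nb ` G 2)"
    using fin by (intro card_mono) auto
  also have "\<dots> \<le> card (G \<epsilon>) + card (G 2) + card (G 2)"
    using card_Un_le[of "G \<epsilon> \<union> G 2" "nb ` G 2"] card_Un_le[of "G \<epsilon>" "G 2"]
      card_image_le[OF fin(2), of nb] by linarith
  finally have "real (card {v\<in>V. block h q v = x}) \<le> real (card (G \<epsilon>)) + 2 * real (card (G 2))"
    by linarith
  also have "\<dots> \<le> 4 * cell_bound"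
    using card_net_cell[of \<epsilon> h k q c] card_net_cell[of 2 h k q c] eps_small cell_bound_ge_1
    unfolding G_def by simp
  finally show ?thesis .
qed

text \<open>The left side bounds the class size
  \<open>(2 * \<beta> + 1) * \<beta> \<le> 3 * \<beta> ^ 2\<close> for block size \<beta>. The
  summand 2 in \<open>cell_bound\<close> is absorbed by doubling the main term, and the exponent of
  \<open>L\<close> is at most \<open>36 * d * L\<close> because
  \<open>m \<le> L + 1\<close>.\<close>

lemma cell_bound_swap_size: "3 * (4 * cell_bound)\<^sup>2 \<le> swap_size d \<epsilon>"
proof -
  have d: "2 \<le> real d" using dim by simp
  have "(1::real) \<le> (real d)\<^sup>2" using d by (intro one_le_power) simp
  moreover have "1 \<le> L ^ (m + 4)" "L \<le> L ^ (m + 4)" using L_ge by (auto intro: self_le_power)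
  ultimately have "1 * 2 \<le> (real d)\<^sup>2 * L ^ (m + 4)" using L_ge by (intro mult_mono) auto
  then have "cell_bound \<le> (2 * ((real d)\<^sup>2 * L ^ (m + 4))) ^ d"
    unfolding cell_bound_def by (intro power_mono) auto
  then have "cell_bound\<^sup>2 \<le> ((2 * ((real d)\<^sup>2 * L ^ (m + 4))) ^ d)\<^sup>2"
    using cell_bound_ge_1 by (intro power_mono) auto
  also have "\<dots> = ((2 * real d ^ 2) * L ^ (m + 4)) ^ (2 * d)"
    by (simp only: power_mult[symmetric] mult.commute[of d 2] mult.assoc)
  also have "\<dots> = (2 * real d ^ 2) ^ (2 * d) * L ^ ((m + 4) * (2 * d))"
    by (simp only: power_mult_distrib power_mult[of L])
  also have "\<dots> \<le> (2 * real d) ^ (4 * d) * L powr (36 * real d * L)"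
  proof (rule mult_mono)
    have "2 * real d ^ 2 \<le> (2 * real d) ^ 2" by (simp add: power_mult_distrib)
    then have "(2 * real d ^ 2) ^ (2 * d) \<le> ((2 * real d) ^ 2) ^ (2 * d)"
      by (intro power_mono) auto
    also have "\<dots> = (2 * real d) ^ (2 * (2 * d))" by (rule power_mult[symmetric])
    finally show "(2 * real d ^ 2) ^ (2 * d) \<le> (2 * real d) ^ (4 * d)" by simp
    have "real ((m + 4) * (2 * d)) = (2 * real m + 8) * real d" by (simp add: algebra_simps)
    also have "\<dots> \<le> (36 * L) * real d"
      using m_bounds L_ge by (intro mult_right_mono) auto
    finally have "real ((m + 4) * (2 * d)) \<le> 36 * real d * L" by (simp add: mult_ac)
    then have "L powr real ((m + 4) * (2 * d)) \<le> L powr (36 * real d * L)"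
      using L_ge by (intro powr_mono) auto
    then show "L ^ ((m + 4) * (2 * d)) \<le> L powr (36 * real d * L)"
      using L_ge powr_realpow[of L "(m + 4) * (2 * d)"] by (simp del: of_nat_mult of_nat_add)
    show "0 \<le> L ^ ((m + 4) * (2 * d))" using L_ge by simp
  qed simp
  finally have 1: "cell_bound\<^sup>2 \<le> (2 * real d) ^ (4 * d) * L powr (36 * real d * L)" .
  \<comment> \<open>The first factor so far is only \<open>(2 * d) ^ (4 * d)\<close>, half the
    allowed exponent; the other half absorbs the passage from 48 to 32.\<close>
  have "2 * real d \<le> (2 * real d) ^ (4 * d)" using d dim by (intro self_le_power) auto
  then have "48 \<le> 32 * (2 * real d) ^ (4 * d)" using d by linarith
  then have "48 * (2 * real d) ^ (4 * d) \<le> (32 * (2 * real d) ^ (4 * d)) * (2 * real d) ^ (4 * d)"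
    by (rule mult_right_mono) simp
  also have "\<dots> = 32 * (2 * real d) ^ (8 * d)"
    using power_add[of "2 * real d" "4 * d" "4 * d"] by (simp only: mult.assoc) simp
  finally have 2: "48 * (2 * real d) ^ (4 * d) \<le> 32 * (2 * real d) ^ (8 * d)" .
  have eps: "\<epsilon> powr (- (36 * real d / \<epsilon>)) = L powr (36 * real d * L)"
    using eps_pos by (simp add: L_def powr_minus_divide powr_divide)
  have "3 * (4 * cell_bound)\<^sup>2 = 48 * cell_bound\<^sup>2" by (simp add: power_mult_distrib)
  also have "\<dots> \<le> 48 * (2 * real d) ^ (4 * d) * L powr (36 * real d * L)" using 1 by simp
  also have "\<dots> \<le> 32 * (2 * real d) ^ (8 * d) * L powr (36 * real d * L)"
    using 2 by (rule mult_right_mono) simp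
  finally show ?thesis by (simp add: swap_size_def eps)
qed

lemma block_coarsening:
  "\<exists>g :: _ \<Rightarrow> nat. \<forall>n. card {a\<in>A. g (block h q a) = n} = card {b\<in>B. g (block h q b) = n} \<and>
    real (card {b\<in>B. g (block h q b) = n}) \<le> swap_size d \<epsilon>"
proof -
  define \<beta> where "\<beta> = nat \<lfloor>4 * cell_bound\<rfloor>"
  have \<beta>: "real \<beta> \<le> 4 * cell_bound" "1 \<le> \<beta>"
    using cell_bound_ge_1 unfolding \<beta>_def by linarith+
  have "card {v\<in>V. block h q v = x} \<le> \<beta>" for x
    using card_block[of h q x] unfolding \<beta>_def by linarith
  from balanced_coarsening[OF finite_A finite_B card_eq this] obtain g :: "_ \<Rightarrow> nat" where
    g: "\<And>n. card {a\<in>A. g (block h q a) = n} = card {b\<in>B. g (block h q b) = n} \<and>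
    card {b\<in>B. g (block h q b) = n} \<le> (2 * \<beta> + 1) * \<beta>" by blast
  have "real ((2 * \<beta> + 1) * \<beta>) \<le> swap_size d \<epsilon>"
  proof -
    have "(2 * \<beta> + 1) * \<beta> \<le> (3 * \<beta>) * \<beta>" using \<beta>(2) by (intro mult_right_mono) auto
    then have "real ((2 * \<beta> + 1) * \<beta>) \<le> real ((3 * \<beta>) * \<beta>)" by (rule of_nat_mono)
    also have "\<dots> = 3 * (real \<beta>)\<^sup>2" by (simp add: power2_eq_square)
    also have "\<dots> \<le> 3 * (4 * cell_bound)\<^sup>2" using \<beta>(1) by (intro mult_left_mono power_mono) auto
    finally show ?thesis using cell_bound_swap_size by linarith
  qed
  with g show ?thesis by (meson of_nat_mono order_trans)
qed

text \<open>The root covering \<open>v\<close> and its partner share their ancestor, hence their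
  block for all shifts. The root is within \<open>2 * D v\<close>, and the partner is at most
  \<open>D v\<close> further away because the root has no larger \<open>D\<close> than
  \<open>v\<close>.\<close>

lemma root_pair_near:
  assumes "v \<in> V"
  obtains s t where "s \<in> A" "t \<in> B" "\<And>h q. block h q s = block h q t"
    "\<delta> s v \<le> 3 * D v" "\<delta> t v \<le> 3 * D v"
proof -
  obtain u where u: "u \<in> net 2" "D u \<le> D v" "\<delta> v u \<le> 2 * D v"
    using net_cover[of 2 v] assms by auto
  have uV: "u \<in> V" using u roots_in_V by blast
  have same: "block h q u = block h q (nb u)" for h q
    using u(1) anc_root anc_nb by (auto simp: block_def essential_def)
  have "\<delta> (nb u) v \<le> \<delta> v u + \<delta> u (nb u)"
    using eucl_dist_triangle[of d v "nb u" u] by (simp add: eucl_dist_commute)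
  then have 1: "\<delta> (nb u) v \<le> 3 * D v" using u nb_dist[OF uV] by simp
  have 2: "\<delta> u v \<le> 3 * D v" using u D_pos[OF assms] by (simp add: eucl_dist_commute)
  show ?thesis
  proof (cases "u \<in> A")
    case True
    then have "nb u \<in> B" using nb_other[OF uV] by (simp add: other_def)
    with True show ?thesis using that[of u "nb u"] same 1 2 by blast
  next
    case False
    then have "nb u \<in> A" "u \<in> B" using nb_other[OF uV] uV by (auto simp: other_def)
    then show ?thesis using that[of "nb u" u] same 1 2 by metis
  qed
qed

text \<open>The covering point is closer to \<open>v\<close> than \<open>D v\<close>, so it cannot
  lie on the opposite side; the Lipschitz property of \<open>D\<close> then keeps its scale
  comparable.\<close>

lemma net_representative:
  assumes "v \<in> V"
  obtains u where "u \<in> net \<epsilon>" "u \<in> V" "other u = other v" "D u \<le> D v" "D v / 2 \<le> D u"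
    "\<delta> u v \<le> \<epsilon> * D v"
proof -
  obtain u where u: "u \<in> net \<epsilon>" "D u \<le> D v" "\<delta> v u \<le> \<epsilon> * D v"
    using net_cover[of \<epsilon> v] assms eps_pos by auto
  have uV: "u \<in> V" using u net_subset[of \<epsilon>] eps_pos by auto
  have "\<epsilon> * D v \<le> 1 / 2 * D v" using eps_small D_pos[OF assms] by (intro mult_right_mono) auto
  then have half: "\<delta> v u \<le> D v / 2" using u by simp
  then have "u \<notin> other v" using D_le[OF assms, of u] D_pos[OF assms] by auto
  then have o: "other u = other v" using other_eqI assms uV by blast
  then have "D v \<le> \<delta> v u + D u" using D_lipschitz[OF assms uV] by simp
  then have "D v / 2 \<le> D u" using half by simp
  with that u uV o show ?thesis by (simp add: eucl_dist_commute)
qed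

subsection \<open>Separation probability\<close>

text \<open>The logarithms of \<open>D x\<close> and \<open>D y\<close> differ by at most 2, so at
  most 3 of the \<open>m\<close> band shifts separate the points, a fraction of at most
  \<open>3 * \<epsilon>\<close>. Within a common band the points are close compared with the cell
  width, and a union bound over coordinates gives a fraction of at most
  \<open>2 * \<epsilon>\<close> of the grid shifts.\<close>

lemma card_separating_shifts:
  assumes x: "x \<in> V" and y: "y \<in> V" and "0 < \<Delta>"
    and Dx: "\<epsilon> * \<Delta> / 6 \<le> D x" "D x \<le> 2 * \<Delta>" and Dy: "\<epsilon> * \<Delta> / 6 \<le> D y" "D y \<le> 2 * \<Delta>"
    and xy: "\<delta> x y \<le> 7 * \<Delta>"
  shows "real (card {(h, q) \<in> {..<m} \<times> {..<M}. (band h x, cell h q x) \<noteq> (band h y, cell h q y)})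
    \<le> 5 * \<epsilon> * (real m * real M)"
proof -
  have L1: "1 < L" using L_ge by simp
  have Delta_le: "\<Delta> \<le> 6 * L * t" if "\<epsilon> * \<Delta> / 6 \<le> t" for t
  proof -
    have "6 * L * (\<epsilon> * \<Delta> / 6) \<le> 6 * L * t" using that L1 by (intro mult_left_mono) auto
    moreover have "6 * L * (\<epsilon> * \<Delta> / 6) = \<Delta>" using eps_pos by (simp add: L_def)
    ultimately show ?thesis by metis
  qed
  have ratio: "log L (D v) \<le> 2 + log L (D w)"
    if "v \<in> V" "w \<in> V" "D v \<le> 2 * \<Delta>" "\<epsilon> * \<Delta> / 6 \<le> D w" for v w
  proof -
    have "D v \<le> 12 * L * D w" using Delta_le[OF that(4)] that(3) by simp
    also have "\<dots> \<le> L * L * D w" using L_ge D_pos[OF that(2)] by (intro mult_right_mono) auto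
    finally have "D v \<le> L ^ 2 * D w" by (simp add: power2_eq_square)
    then have "log L (D v) \<le> log L (L ^ 2 * D w)"
      using L1 D_pos[OF that(1)] D_pos[OF that(2)] by simp
    also have "\<dots> = 2 + log L (D w)"
      using L1 D_pos[OF that(2)] by (simp add: log_mult log_nat_power)
    finally show ?thesis .
  qed
  have "real (card {h. h < m \<and> band h x \<noteq> band h y})
    \<le> real m * \<bar>log L (D x) / real m - log L (D y) / real m\<bar> + 1"
    unfolding band_def by (rule card_floor_shift[OF m_bounds(1)])
  also have "real m * \<bar>log L (D x) / real m - log L (D y) / real m\<bar> = \<bar>log L (D x) - log L (D y)\<bar>"
    using m_bounds(1) by (simp add: diff_divide_distrib[symmetric])
  also have "\<dots> \<le> 2" using ratio[OF x y Dx(2) Dy(1)] ratio[OF y x Dy(2) Dx(1)] by linarith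
  finally have bands: "real (card {h. h < m \<and> band h x \<noteq> band h y}) \<le> 3" by simp
  have cells: "real (card {q. q < M \<and> cell h q x \<noteq> cell h q y}) \<le> 2 * real M / L"
    if eq: "band h x = band h y" for h
  proof -
    define W where "W = width h (band h x)"
    define R where "R = L powr (real m * (real_of_int (band h x) + 1) - real h)"
    have W: "0 < W" unfolding W_def by (rule width_pos)
    have R: "0 < R" using L1 by (simp add: R_def)
    have "\<Delta> \<le> 6 * L * D x" by (rule Delta_le[OF Dx(1)])
    also have "\<dots> \<le> 6 * L * R"
      using band_bounds(2)[OF x refl, of h] L1 by (intro mult_left_mono) (auto simp: R_def)
    finally have "\<delta> x y \<le> 42 * L * R" using xy by simp
    \<comment> \<open>Here 42 is the product of 7 from the distance bound and 6 from the lower bound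
      on \<open>D x\<close>; this is the reason for the hypothesis
      \<open>\<epsilon> \<le> 1 / 42\<close>.\<close>
    also have "\<dots> \<le> L * L * R" using L_ge R by (intro mult_right_mono) auto
    also have "\<dots> = W / (real d * L)"
      using L1 dim by (simp add: W_def width_def R_def power3_eq_cube)
    finally have xyW: "\<delta> x y / W \<le> 1 / (real d * L)" using W by (simp add: field_simps)
    let ?Q = "\<lambda>i. {q. q < M \<and> \<lfloor>x i / W + real q / real M\<rfloor> \<noteq> \<lfloor>y i / W + real q / real M\<rfloor>}"
    have "{q. q < M \<and> cell h q x \<noteq> cell h q y} \<subseteq> (\<Union>i<d. ?Q i)"
    proof
      fix q assume q: "q \<in> {q. q < M \<and> cell h q x \<noteq> cell h q y}"
      then obtain i where i: "cell h q x i \<noteq> cell h q y i" by (auto simp: fun_eq_iff)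
      then have "i < d" by (simp add: cell_def split: if_splits)
      with i q show "q \<in> (\<Union>i<d. ?Q i)" by (auto simp: cell_def W_def eq)
    qed
    then have "card {q. q < M \<and> cell h q x \<noteq> cell h q y} \<le> card (\<Union>i<d. ?Q i)"
      by (intro card_mono) auto
    also have "\<dots> \<le> (\<Sum>i<d. card (?Q i))" by (intro card_UN_le) auto
    finally have "real (card {q. q < M \<and> cell h q x \<noteq> cell h q y}) 
      \<le> real (\<Sum>i<d. card (?Q i))" by (rule of_nat_mono)
    also have "\<dots> = (\<Sum>i<d. real (card (?Q i)))" by (rule of_nat_sum)
    \<comment> \<open>The summand 1 is the rounding loss of a discrete shift. Over all coordinates
      it amounts to \<open>d\<close>, which is at most \<open>M / L\<close>.\<close>
    also have "\<dots> \<le> (\<Sum>i<d. real M * (1 / (real d * L)) + 1)"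
    proof (rule sum_mono)
      fix i assume "i \<in> {..<d}"
      then have "\<bar>x i - y i\<bar> / W \<le> \<delta> x y / W"
        using W coordinate_le_eucl_dist[of i d x y] by (intro divide_right_mono) auto
      then have "\<bar>x i / W - y i / W\<bar> \<le> 1 / (real d * L)"
        using xyW W by (simp add: diff_divide_distrib[symmetric])
      then have "real M * \<bar>x i / W - y i / W\<bar> \<le> real M * (1 / (real d * L))"
        by (intro mult_left_mono) auto
      with card_floor_shift[OF M_bounds(1), of "x i / W" "y i / W"]
      show "real (card (?Q i)) \<le> real M * (1 / (real d * L)) + 1" by linarith
    qed
    also have "\<dots> = real M / L + real d" using dim L1 by (simp add: field_simps)
    also have "\<dots> \<le> 2 * real M / L" using M_bounds(2) L1 by (simp add: field_simps)
    finally show ?thesis .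
  qed
  let ?P = "\<lambda>h q. (band h x, cell h q x) \<noteq> (band h y, cell h q y)"
  have "{(h, q) \<in> {..<m} \<times> {..<M}. ?P h q} = (SIGMA h:{..<m}. {q. q < M \<and> ?P h q})" by auto
  then have "real (card {(h, q) \<in> {..<m} \<times> {..<M}. ?P h q})
    = (\<Sum>h<m. real (card {q. q < M \<and> ?P h q}))"
    by (simp only: card_SigmaI[of "{..<m}"] finite_lessThan) (simp add: card_SigmaI)
  also have "\<dots> \<le> (\<Sum>h<m. (if band h x \<noteq> band h y then real M else 0) + 2 * real M / L)"
  proof (rule sum_mono)
    fix h
    show "real (card {q. q < M \<and> ?P h q}) \<le> (if band h x \<noteq> band h y then real M else 0) + 2 * real M / L"
    proof (cases "band h x = band h y")
      case True
      then show ?thesis using cells[OF True] by simp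
    next
      case False
      have "card {q. q < M \<and> ?P h q} \<le> card {..<M}" by (intro card_mono) auto
      then show ?thesis using False L1 by (simp add: add_increasing2)
    qed
  qed
  also have "\<dots> = real (card {h. h < m \<and> band h x \<noteq> band h y}) * real M + real m * (2 * real M / L)"
    by (simp add: sum.distrib sum.If_cases Int_def conj_commute)
  also have "\<dots> \<le> 3 * real M + real m * (2 * real M / L)"
    using bands by (intro add_right_mono mult_right_mono) auto
  also have "\<dots> \<le> 3 * (real m / L) * real M + real m * (2 * real M / L)"
  proof -
    have "1 \<le> real m / L" using m_bounds(2) L1 by (simp add: field_simps)
    then have "3 * 1 * real M \<le> 3 * (real m / L) * real M"
      by (intro mult_right_mono mult_left_mono) auto
    then show ?thesis by (intro add_right_mono) (simp only: mult_1_right)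
  qed
  also have "\<dots> = 5 * \<epsilon> * (real m * real M)" by (simp add: L_def algebra_simps)
  finally show ?thesis .
qed

text \<open>\<Omega> consists of all pairs of shifts, counted uniformly, and classes are unions of
  blocks, so points of one block stay together. If \<open>3 * D a\<close> or \<open>3 * D b\<close>
  is at most \<open>\<epsilon> * \<delta> a b\<close>, a root pair links for every shift. Otherwise
  the representatives in the fine net link unless the shifts separate their ancestors. The constant
  3 always works since \<open>D a \<le> \<delta> a b\<close>.\<close>

theorem linked_balanced_partitions:
  obtains \<Omega> :: "(nat \<times> nat) set" and f :: "nat \<times> nat \<Rightarrow> (nat \<Rightarrow> real) \<Rightarrow> nat"
  where "finite \<Omega>" "\<Omega> \<noteq> {}"
    and "\<And>\<omega> n. card {a\<in>A. f \<omega> a = n} = card {b\<in>B. f \<omega> b = n}"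
    and "\<And>\<omega> n. real (card {b\<in>B. f \<omega> b = n}) \<le> swap_size d \<epsilon>"
    and "\<And>\<omega> a b. a \<in> A \<Longrightarrow> b \<in> B \<Longrightarrow> linked d A B (f \<omega>) 3 a b"
    and "\<And>a b. a \<in> A \<Longrightarrow> b \<in> B \<Longrightarrow>
      real (card {\<omega>\<in>\<Omega>. \<not> linked d A B (f \<omega>) \<epsilon> a b}) \<le> 5 * \<epsilon> * real (card \<Omega>)"
proof -
  define g where "g = (\<lambda>h q. SOME g :: _ \<Rightarrow> nat.
    \<forall>n. card {a\<in>A. g (block h q a) = n} = card {b\<in>B. g (block h q b) = n} \<and>
    real (card {b\<in>B. g (block h q b) = n}) \<le> swap_size d \<epsilon>)"
  have g: "\<forall>n. card {a\<in>A. g h q (block h q a) = n} = card {b\<in>B. g h q (block h q b) = n} \<and>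
    real (card {b\<in>B. g h q (block h q b) = n}) \<le> swap_size d \<epsilon>" for h q
    unfolding g_def by (rule someI_ex[OF block_coarsening])
  define f where "f = (\<lambda>(h, q) v. g h q (block h q v))"
  define \<Omega> where "\<Omega> = {..<m} \<times> {..<M}"
  have f_eqI: "f \<omega> s = f \<omega> t" if "\<And>h q. \<omega> = (h, q) \<Longrightarrow> block h q s = block h q t" for \<omega> s t
    using that by (cases \<omega>) (simp add: f_def)
  have near: "linked d A B (f \<omega>) \<tau> a b"
    if "a \<in> A" "b \<in> B" "3 * D a \<le> \<tau> * \<delta> a b \<or> 3 * D b \<le> \<tau> * \<delta> a b" for \<omega> a b \<tau>
    using that(3)
  proof
    assume *: "3 * D a \<le> \<tau> * \<delta> a b"
    obtain s t where st: "s \<in> A" "t \<in> B" "\<And>h q. block h q s = block h q t"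
      "\<delta> s a \<le> 3 * D a" "\<delta> t a \<le> 3 * D a" using root_pair_near[OF UnI1[OF \<open>a \<in> A\<close>]] by blast
    then show ?thesis unfolding linked_def using * f_eqI[of \<omega> s t] by (intro bexI[of _ s] bexI[of _ t]) auto
  next
    assume *: "3 * D b \<le> \<tau> * \<delta> a b"
    obtain s t where st: "s \<in> A" "t \<in> B" "\<And>h q. block h q s = block h q t"
      "\<delta> s b \<le> 3 * D b" "\<delta> t b \<le> 3 * D b" using root_pair_near[OF UnI2[OF \<open>b \<in> B\<close>]] by blast
    then show ?thesis unfolding linked_def using * f_eqI[of \<omega> s t] by (intro bexI[of _ s] bexI[of _ t]) auto
  qed
  have Dab: "D a \<le> \<delta> a b" "D b \<le> \<delta> a b" if "a \<in> A" "b \<in> B" for a b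
  proof -
    have "b \<notin> A" using that disjoint by blast
    then show "D a \<le> \<delta> a b" "D b \<le> \<delta> a b"
      using D_le[of a b] D_le[of b a] that eucl_dist_commute[of d a b] by (auto simp: other_def)
  qed
  have bad: "real (card {\<omega>\<in>\<Omega>. \<not> linked d A B (f \<omega>) \<epsilon> a b}) \<le> 5 * \<epsilon> * real (card \<Omega>)"
    if ab: "a \<in> A" "b \<in> B" for a b
  proof (cases "3 * D a \<le> \<epsilon> * \<delta> a b \<or> 3 * D b \<le> \<epsilon> * \<delta> a b")
    case True
    then have "{\<omega>\<in>\<Omega>. \<not> linked d A B (f \<omega>) \<epsilon> a b} = {}" using near[OF ab] by auto
    then show ?thesis using eps_pos by (simp only: card.empty) simp
  next
    case False
    define \<Delta> where "\<Delta> = \<delta> a b"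
    have V: "a \<in> V" "b \<in> V" using ab by auto
    note DD = Dab[OF ab, folded \<Delta>_def]
    have pos: "0 < \<Delta>" using DD D_pos[OF V(1)] by simp
    obtain s where s: "s \<in> net \<epsilon>" "s \<in> V" "other s = other a" "D s \<le> D a" "D a / 2 \<le> D s"
      "\<delta> s a \<le> \<epsilon> * D a" using net_representative[OF V(1)] by blast
    obtain t where t: "t \<in> net \<epsilon>" "t \<in> V" "other t = other b" "D t \<le> D b" "D b / 2 \<le> D t"
      "\<delta> t b \<le> \<epsilon> * D b" using net_representative[OF V(2)] by blast
    have sA: "s \<in> A" and tB: "t \<in> B"
      using s(2,3) t(2,3) ab disjoint by (auto simp: other_def split: if_splits)
    have "\<epsilon> * D a \<le> \<epsilon> * \<Delta>" "\<epsilon> * D b \<le> \<epsilon> * \<Delta>" using DD eps_pos by auto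
    then have sa: "\<delta> s a \<le> \<epsilon> * \<Delta>" and tb: "\<delta> t b \<le> \<epsilon> * \<Delta>" using s t by linarith+
    have "\<epsilon> * \<Delta> \<le> 1 / 2 * \<Delta>" using pos eps_small by (intro mult_right_mono) auto
    then have sa': "\<delta> s a \<le> \<Delta> / 2" and tb': "\<delta> t b \<le> \<Delta> / 2" using sa tb by linarith+
    note as = anc_bounds[OF s(2)] and at = anc_bounds[OF t(2)]
    \<comment> \<open>The 6 arises from the excluded case, which gives
      \<open>D a > \<epsilon> * \<Delta> / 3\<close>, and from the factor 2 lost to the
      representative; ancestors lose nothing in this direction.\<close>
    have lo: "\<epsilon> * \<Delta> / 6 \<le> D (anc s)" "\<epsilon> * \<Delta> / 6 \<le> D (anc t)"
      using False s(5) t(5) as(2) at(2) unfolding \<Delta>_def by linarith+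
    have hi: "D (anc s) \<le> 2 * \<Delta>" "D (anc t) \<le> 2 * \<Delta>"
      using DD s(4) t(4) as(3) at(3) by linarith+
    have "\<delta> (anc s) (anc t) \<le> \<delta> s (anc s) + \<delta> s a + \<Delta> + \<delta> t b + \<delta> t (anc t)"
      using eucl_dist_triangle[of d "anc s" "anc t" s] eucl_dist_triangle[of d s "anc t" a]
        eucl_dist_triangle[of d a "anc t" b] eucl_dist_triangle[of d b "anc t" t]
        eucl_dist_commute[of d s "anc s"] eucl_dist_commute[of d t b]
      unfolding \<Delta>_def by linarith
    also have "\<dots> \<le> 7 * \<Delta>" using as(4) at(4) s(4) t(4) DD sa' tb' pos by linarith
    finally have dist: "\<delta> (anc s) (anc t) \<le> 7 * \<Delta>" .
    have ess: "s \<in> essential" "t \<in> essential" using s t by (auto simp: essential_def)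
    have "linked d A B (f (h, q)) \<epsilon> a b"
      if "(band h (anc s), cell h q (anc s)) = (band h (anc t), cell h q (anc t))" for h q
    proof -
      have "f (h, q) s = f (h, q) t" using that ess by (simp add: f_def block_def)
      then show ?thesis unfolding linked_def using sA tB sa tb
        by (intro bexI[of _ s] bexI[of _ t]) (auto simp: \<Delta>_def)
    qed
    then have "{\<omega>\<in>\<Omega>. \<not> linked d A B (f \<omega>) \<epsilon> a b} \<subseteq> {(h, q) \<in> {..<m} \<times> {..<M}.
      (band h (anc s), cell h q (anc s)) \<noteq> (band h (anc t), cell h q (anc t))}"
      unfolding \<Omega>_def by blast
    then have "card {\<omega>\<in>\<Omega>. \<not> linked d A B (f \<omega>) \<epsilon> a b} \<le> card {(h, q) \<in> {..<m} \<times> {..<M}.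
      (band h (anc s), cell h q (anc s)) \<noteq> (band h (anc t), cell h q (anc t))}"
      by (rule card_mono[rotated]) (auto intro: finite_subset[of _ "{..<m} \<times> {..<M}"])
    then have "real (card {\<omega>\<in>\<Omega>. \<not> linked d A B (f \<omega>) \<epsilon> a b}) \<le> real (card {(h, q) \<in> {..<m} \<times> {..<M}.
      (band h (anc s), cell h q (anc s)) \<noteq> (band h (anc t), cell h q (anc t))})"
      by simp
    also have "\<dots> \<le> 5 * \<epsilon> * (real m * real M)"
      by (rule card_separating_shifts[OF as(1) at(1) pos lo(1) hi(1) lo(2) hi(2) dist])
    finally show ?thesis by (simp add: \<Omega>_def card_cartesian_product)
  qed
  show ?thesis
  proof (rule that)
    show "finite \<Omega>" "\<Omega> \<noteq> {}" using m_bounds(1) M_bounds(1) by (auto simp: \<Omega>_def)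
    show "card {a\<in>A. f \<omega> a = n} = card {b\<in>B. f \<omega> b = n}"
      and "real (card {b\<in>B. f \<omega> b = n}) \<le> swap_size d \<epsilon>" for \<omega> n
      using g by (cases \<omega>; simp add: f_def)+
    show "linked d A B (f \<omega>) 3 a b" if "a \<in> A" "b \<in> B" for \<omega> a b
      using near[OF that, of 3] Dab[OF that] by simp
  qed (rule bad)
qed

end

subsection \<open>Clients\<close>

lemma dist_to_centers_le:
  "finite S \<Longrightarrow> i \<in> S \<Longrightarrow> dist_to_centers d j S \<le> eucl_dist d j i"
  by (simp add: dist_to_centers_def)

lemma dist_to_centers_attained:
  assumes "finite S" "S \<noteq> {}"
  obtains i where "i \<in> S" "dist_to_centers d j S = eucl_dist d j i"
proof -
  have "dist_to_centers d j S \<in> eucl_dist d j ` S"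
    unfolding dist_to_centers_def using assms by (intro Min_in) auto
  with that show ?thesis by blast
qed

lemma dist_to_centers_nonneg:
  assumes "finite S" "S \<noteq> {}"
  shows "0 \<le> dist_to_centers d j S"
  using dist_to_centers_attained[OF assms, of d j] by (metis eucl_dist_nonneg)

text \<open>Used with \<open>u = c\<close> and \<open>u = e\<close>: a client at distance
  \<open>u\<close> from a center is rerouted to a center at most \<open>\<tau> * (c + e)\<close>
  away from it. The excess is at most
  \<open>(2 * \<tau> + \<tau> ^ 2) * (c + e) ^ 2\<close>.\<close>

lemma detour_square_le:
  fixes c e \<tau> u :: real
  assumes "0 \<le> c" "0 \<le> e" "0 \<le> \<tau>" "0 \<le> u" "u \<le> c + e"
  shows "(u + \<tau> * (c + e))\<^sup>2 \<le> u\<^sup>2 + 2 * (2 * \<tau> + \<tau>\<^sup>2) * (c\<^sup>2 + e\<^sup>2)"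
proof -
  have "(c + e)\<^sup>2 \<le> 2 * (c\<^sup>2 + e\<^sup>2)"
    using sum_squares_bound[of c e] by (simp add: power2_sum)
  then have 1: "(2 * \<tau> + \<tau>\<^sup>2) * (c + e)\<^sup>2 \<le> (2 * \<tau> + \<tau>\<^sup>2) * (2 * (c\<^sup>2 + e\<^sup>2))"
    using assms by (intro mult_left_mono) auto
  have 2: "2 * \<tau> * (u * (c + e)) \<le> 2 * \<tau> * ((c + e) * (c + e))"
    using assms by (intro mult_left_mono mult_right_mono) auto
  have "(u + \<tau> * (c + e))\<^sup>2 = u\<^sup>2 + 2 * \<tau> * (u * (c + e)) + \<tau>\<^sup>2 * (c + e)\<^sup>2"
    by (simp add: power2_eq_square algebra_simps)
  also have "\<dots> \<le> u\<^sup>2 + 2 * \<tau> * ((c + e) * (c + e)) + \<tau>\<^sup>2 * (c + e)\<^sup>2" using 2 by simp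
  also have "\<dots> = u\<^sup>2 + (2 * \<tau> + \<tau>\<^sup>2) * (c + e)\<^sup>2"
    by (simp add: power2_eq_square algebra_simps)
  also have "\<dots> \<le> u\<^sup>2 + (2 * \<tau> + \<tau>\<^sup>2) * (2 * (c\<^sup>2 + e\<^sup>2))" using 1 by simp
  finally show ?thesis by (simp add: algebra_simps)
qed

lemma sum_le_single:
  fixes x :: "'a \<Rightarrow> real"
  assumes "finite N" "n0 \<in> N" "\<And>n. n \<in> N \<Longrightarrow> n \<noteq> n0 \<Longrightarrow> x n \<le> 0"
  shows "sum x N \<le> x n0"
proof -
  have "sum x N = x n0 + sum x (N - {n0})" using assms by (simp add: sum.remove)
  moreover have "sum x (N - {n0}) \<le> 0" using assms by (intro sum_nonpos) auto
  ultimately show ?thesis by simp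
qed

section \<open>Effect of all swaps of one partition on a single client\<close>

definition swapped where
  "swapped S T f n = (S - {a \<in> S - T. f a = n}) \<union> {b \<in> T - S. f b = n}"

text \<open>Only the swap that closes \<open>i\<close> can raise the cost of the client, and a swap
  after which \<open>i'\<close> is open changes it by at most \<open>e\<^sup>2 - c\<^sup>2\<close>.
  The critical case has \<open>i\<close> and \<open>i'\<close> in different classes: the swap
  closing \<open>i\<close> is then charged to a center of the linked pair.\<close>

lemma total_swap_change_le:
  fixes f :: "(nat \<Rightarrow> real) \<Rightarrow> nat"
  assumes fin: "finite S" "finite T" and ne: "\<And>n. swapped S T f n \<noteq> {}"
    and N: "finite N" "f ` ((S - T) \<union> (T - S)) \<subseteq> N"
    and i: "i \<in> S" "dist_to_centers d j S = eucl_dist d j i"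
    and i': "i' \<in> T" "dist_to_centers d j T = eucl_dist d j i'"
    and \<tau>: "0 \<le> \<tau>"
    and link: "i \<in> S - T \<Longrightarrow> i' \<in> T - S \<Longrightarrow> linked d (S - T) (T - S) f \<tau> i i'"
  defines "c \<equiv> dist_to_centers d j S" and "e \<equiv> dist_to_centers d j T"
  shows "(\<Sum>n\<in>N. (dist_to_centers d j (swapped S T f n))\<^sup>2 - c\<^sup>2)
    \<le> e\<^sup>2 - c\<^sup>2 + 2 * (2 * \<tau> + \<tau>\<^sup>2) * (c\<^sup>2 + e\<^sup>2)"
proof -
  define x where "x n = (dist_to_centers d j (swapped S T f n))\<^sup>2 - c\<^sup>2" for n
  define \<eta> where "\<eta> = 2 * (2 * \<tau> + \<tau>\<^sup>2) * (c\<^sup>2 + e\<^sup>2)"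
  have \<eta>: "0 \<le> \<eta>" using \<tau> by (simp add: \<eta>_def)
  have ce: "0 \<le> c" "0 \<le> e" using i i' by (auto simp: c_def e_def)
  have fsw: "finite (swapped S T f n)" for n using fin by (auto simp: swapped_def)
  have x_le: "x n \<le> y\<^sup>2 - c\<^sup>2" if "w \<in> swapped S T f n" "eucl_dist d j w \<le> y" for n w y
  proof -
    have "dist_to_centers d j (swapped S T f n) \<le> y"
      using dist_to_centers_le[OF fsw that(1), of d j] that(2) by simp
    then show ?thesis
      unfolding x_def using dist_to_centers_nonneg[OF fsw ne] by (simp add: power_mono)
  qed
  have keep: "x n \<le> 0" if "i \<notin> S - T \<or> f i \<noteq> n" for n
    using x_le[of i n c] i that by (auto simp: swapped_def c_def)
  have gain: "x n \<le> e\<^sup>2 - c\<^sup>2" if "i' \<in> S \<or> f i' = n" for n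
    using x_le[of i' n e] i' that by (auto simp: swapped_def e_def)
  have common: "c \<le> e" if "i' \<in> S"
    using dist_to_centers_le[OF fin(1) that, of d j] i' by (simp add: c_def e_def)
  have "sum x N \<le> e\<^sup>2 - c\<^sup>2 + \<eta>"
  proof (cases "i \<in> S - T")
    case False
    then have nonpos: "x n \<le> 0" for n using keep by blast
    show ?thesis
    proof (cases "i' \<in> S")
      case True
      have "sum x N \<le> 0" using nonpos by (intro sum_nonpos) auto
      moreover have "c\<^sup>2 \<le> e\<^sup>2" using common[OF True] ce by (intro power_mono) auto
      ultimately show ?thesis using \<eta> by linarith
    next
      case False
      then have "f i' \<in> N" using N i' by blast
      then have "sum x N \<le> x (f i')" using nonpos N by (intro sum_le_single) auto
      then show ?thesis using gain[of "f i'"] \<eta> by linarith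
    qed
  next
    case True
    then have n0: "f i \<in> N" using N by blast
    have rest: "x n \<le> 0" if "n \<noteq> f i" for n using keep[of n] that by simp
    show ?thesis
    proof (cases "i' \<in> S \<or> f i' = f i")
      case True
      have "sum x N \<le> x (f i)" using n0 N rest by (intro sum_le_single) auto
      then show ?thesis using gain[OF True] \<eta> by linarith
    next
      case False
      then have i'B: "i' \<in> T - S" using i' by blast
      have n1: "f i' \<in> N - {f i}" using N i'B False by blast
      have "sum x N = x (f i) + sum x (N - {f i})" using N n0 by (simp add: sum.remove)
      also have "sum x (N - {f i}) \<le> x (f i')"
        using n1 N rest by (intro sum_le_single) auto
      finally have sum: "sum x N \<le> x (f i) + x (f i')" by simp
      have x1: "x (f i') \<le> 0" "x (f i') \<le> e\<^sup>2 - c\<^sup>2" using rest gain n1 by auto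
      obtain s t where st: "s \<in> S - T" "t \<in> T - S" "f s = f t"
        "\<forall>v\<in>{s, t}. eucl_dist d v i \<le> \<tau> * eucl_dist d i i' \<or> eucl_dist d v i' \<le> \<tau> * eucl_dist d i i'"
        using link[OF True i'B] unfolding linked_def by blast
      \<comment> \<open>If the pair belongs to the class of \<open>i\<close>, its swap opens
        \<open>t\<close>; otherwise it leaves \<open>s\<close> open.\<close>
      have "\<exists>w\<in>{s, t}. w \<in> swapped S T f (f i)"
        using st(1-3) by (cases "f s = f i") (auto simp: swapped_def)
      then obtain w where w: "w \<in> swapped S T f (f i)"
        "eucl_dist d w i \<le> \<tau> * eucl_dist d i i' \<or> eucl_dist d w i' \<le> \<tau> * eucl_dist d i i'"
        using st(4) by blast
      have "eucl_dist d i i' \<le> c + e"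
        using eucl_dist_triangle[of d i i' j] eucl_dist_commute[of d i j] i(2) i'(2)
        by (simp add: c_def e_def)
      then have le: "\<tau> * eucl_dist d i i' \<le> \<tau> * (c + e)" using \<tau> by (rule mult_left_mono)
      from w(2) show ?thesis
      proof
        assume "eucl_dist d w i \<le> \<tau> * eucl_dist d i i'"
        then have "eucl_dist d j w \<le> c + \<tau> * (c + e)"
          using eucl_dist_triangle[of d j w i] eucl_dist_commute[of d w i] le i(2)
          by (simp add: c_def)
        \<comment> \<open>Near \<open>i\<close> the rerouting costs only \<eta>, and the gain comes
          from the swap that opens \<open>i'\<close>.\<close>
        from x_le[OF w(1) this] have "x (f i) \<le> \<eta>"
          using detour_square_le[of c e \<tau> c] ce \<tau> by (simp add: \<eta>_def)
        then show ?thesis using sum x1 by linarith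
      next
        assume "eucl_dist d w i' \<le> \<tau> * eucl_dist d i i'"
        then have "eucl_dist d j w \<le> e + \<tau> * (c + e)"
          using eucl_dist_triangle[of d j w i'] eucl_dist_commute[of d w i'] le i'(2)
          by (simp add: e_def)
        \<comment> \<open>Near \<open>i'\<close> the rerouting itself yields the gain, and the swap
          that opens \<open>i'\<close> need only be nonpositive.\<close>
        from x_le[OF w(1) this] have "x (f i) \<le> e\<^sup>2 - c\<^sup>2 + \<eta>"
          using detour_square_le[of c e \<tau> e] ce \<tau> by (simp add: \<eta>_def)
        then show ?thesis using sum x1 by linarith
      qed
    qed
  qed
  then show ?thesis by (simp add: x_def \<eta>_def)
qed

text \<open>The nonnegative cost changes of all swaps are summed over all partitions in \<Omega>,
  and the sums are exchanged to bound them client by client. A good partition costs a client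
  \<open>6 * \<epsilon>\<close> and a bad one at most 30 more, relative to
  \<open>c\<^sup>2 + e\<^sup>2\<close>; the bad fraction is at most \<open>5 * \<epsilon>\<close>,
  which gives \<open>6 + 150 = 156\<close>.\<close>

lemma local_optimum_cost_le:
  assumes eps: "0 < \<epsilon>" "\<epsilon> \<le> 1 / 42" and d: "2 \<le> d"
    and fin: "finite S" "finite T" and card: "card S = card T" and "S \<noteq> {}"
    and space: "S \<union> T \<subseteq> topspace (Euclidean_space d)" and "T \<subseteq> C"
    and opt: "swap_locally_optimal d X C (swap_size d \<epsilon>) S"
  shows "kmeans_cost d X S \<le> kmeans_cost d X T
    + 156 * \<epsilon> * (kmeans_cost d X S + kmeans_cost d X T)"
proof -
  define A B where "A = S - T" and "B = T - S"
  have "card A + card (S \<inter> T) = card S" "card B + card (S \<inter> T) = card T"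
    unfolding A_def B_def using fin
    by (metis Int_commute card_Diff_subset_Int card_mono finite_Int inf_le1 le_add_diff_inverse2)+
  then have cardAB: "card A = card B" using card by simp
  interpret two_center_sets d A B \<epsilon>
    using fin cardAB space eps d by unfold_locales (auto simp: A_def B_def)
  obtain \<Omega> :: "(nat \<times> nat) set" and f :: "nat \<times> nat \<Rightarrow> (nat \<Rightarrow> real) \<Rightarrow> nat"
    where \<Omega>: "finite \<Omega>" "\<Omega> \<noteq> {}"
    and bal: "\<And>\<omega> n. card {a\<in>A. f \<omega> a = n} = card {b\<in>B. f \<omega> b = n}"
    and small: "\<And>\<omega> n. real (card {b\<in>B. f \<omega> b = n}) \<le> swap_size d \<epsilon>"
    and linked3: "\<And>\<omega> a b. a \<in> A \<Longrightarrow> b \<in> B \<Longrightarrow> linked d A B (f \<omega>) 3 a b"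
    and bad: "\<And>a b. a \<in> A \<Longrightarrow> b \<in> B \<Longrightarrow>
      real (card {\<omega>\<in>\<Omega>. \<not> linked d A B (f \<omega>) \<epsilon> a b}) \<le> 5 * \<epsilon> * real (card \<Omega>)"
    using linked_balanced_partitions by blast
  have T: "T \<noteq> {}" using card fin \<open>S \<noteq> {}\<close> by auto
  define c e where "c j = dist_to_centers d j S" and "e j = dist_to_centers d j T" for j
  define N where "N \<omega> = f \<omega> ` (A \<union> B)" for \<omega>
  define x where "x \<omega> n j = (dist_to_centers d j (swapped S T (f \<omega>) n))\<^sup>2 - (c j)\<^sup>2" for \<omega> n j
  \<comment> \<open>Distances to an empty set would be unspecified. A swap that left no center would
    open none, hence by balance close none, and \<open>S\<close> itself would remain.\<close>
  have sw_ne: "swapped S T (f \<omega>) n \<noteq> {}" for \<omega> n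
  proof
    assume emp: "swapped S T (f \<omega>) n = {}"
    then have "{b\<in>B. f \<omega> b = n} = {}" by (auto simp: swapped_def B_def)
    with bal[of \<omega> n] have "card {a\<in>A. f \<omega> a = n} = 0" by (simp only: card.empty)
    then have "{a\<in>A. f \<omega> a = n} = {}" using finite_A by simp
    then have "S \<subseteq> swapped S T (f \<omega>) n" by (auto simp: swapped_def A_def)
    with emp \<open>S \<noteq> {}\<close> show False by simp
  qed
  have swap: "0 \<le> (\<Sum>j\<in>X. x \<omega> n j)" for \<omega> n
  proof -
    let ?P = "{b\<in>B. f \<omega> b = n}" and ?Q = "{a\<in>A. f \<omega> a = n}"
    have "?P \<subseteq> C - S" "?Q \<subseteq> S" using \<open>T \<subseteq> C\<close> by (auto simp: A_def B_def)
    moreover have "card ?P = card ?Q" "real (card ?Q) \<le> swap_size d \<epsilon>"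
      using bal[of \<omega> n] small[of \<omega> n] by simp_all
    ultimately have "\<not> kmeans_cost d X ((S - ?Q) \<union> ?P) < kmeans_cost d X S"
      using opt unfolding swap_locally_optimal_def by blast
    moreover have "(S - ?Q) \<union> ?P = swapped S T (f \<omega>) n"
      by (simp add: swapped_def A_def B_def)
    ultimately show ?thesis by (simp add: x_def c_def kmeans_cost_def sum_subtractf)
  qed
  have client: "(\<Sum>\<omega>\<in>\<Omega>. \<Sum>n\<in>N \<omega>. x \<omega> n j)
    \<le> real (card \<Omega>) * ((e j)\<^sup>2 - (c j)\<^sup>2 + 156 * \<epsilon> * ((c j)\<^sup>2 + (e j)\<^sup>2))" for j
  proof -
    obtain i where i: "i \<in> S" "dist_to_centers d j S = eucl_dist d j i"
      using dist_to_centers_attained[OF fin(1) \<open>S \<noteq> {}\<close>] by blast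
    obtain i' where i': "i' \<in> T" "dist_to_centers d j T = eucl_dist d j i'"
      using dist_to_centers_attained[OF fin(2) T] by blast
    define Z where "Z = {\<omega>\<in>\<Omega>. i \<in> A \<and> i' \<in> B \<and> \<not> linked d A B (f \<omega>) \<epsilon> i i'}"
    define y where "y = (c j)\<^sup>2 + (e j)\<^sup>2"
    have y: "0 \<le> y" by (simp add: y_def)
    have Z: "real (card Z) \<le> 5 * \<epsilon> * real (card \<Omega>)"
      using bad[of i i'] eps by (cases "i \<in> A \<and> i' \<in> B") (auto simp: Z_def)
    have "(\<Sum>n\<in>N \<omega>. x \<omega> n j) \<le> (e j)\<^sup>2 - (c j)\<^sup>2 + (6 * \<epsilon> + (if \<omega> \<in> Z then 30 else 0)) * y"
      if "\<omega> \<in> \<Omega>" for \<omega>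
    proof -
      have bound: "(\<Sum>n\<in>N \<omega>. x \<omega> n j) \<le> (e j)\<^sup>2 - (c j)\<^sup>2 + 2 * (2 * \<tau> + \<tau>\<^sup>2) * y"
        if "0 \<le> \<tau>" "i \<in> A \<Longrightarrow> i' \<in> B \<Longrightarrow> linked d A B (f \<omega>) \<tau> i i'" for \<tau>
        unfolding x_def c_def e_def y_def
        using fin sw_ne i i' that finite_A finite_B
        by (intro total_swap_change_le) (auto simp: N_def A_def B_def)
      show ?thesis
      proof (cases "\<omega> \<in> Z")
        case True
        \<comment> \<open>The value 30 is the coefficient
          \<open>2 * (2 * \<tau> + \<tau>\<^sup>2)\<close> at \<open>\<tau> = 3\<close>, the link
          that never fails.\<close>
        have "2 * (2 * 3 + 3\<^sup>2) * y \<le> (6 * \<epsilon> + 30) * y"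
          using eps y by (intro mult_right_mono) auto
        then show ?thesis using bound[of 3] linked3 True by auto
      next
        case False
        have "\<epsilon>\<^sup>2 \<le> \<epsilon>" using eps by (simp add: power2_eq_square mult_left_le)
        then have "2 * (2 * \<epsilon> + \<epsilon>\<^sup>2) * y \<le> (6 * \<epsilon>) * y"
          using y by (intro mult_right_mono) auto
        moreover have "(\<Sum>n\<in>N \<omega>. x \<omega> n j) \<le> (e j)\<^sup>2 - (c j)\<^sup>2 + 2 * (2 * \<epsilon> + \<epsilon>\<^sup>2) * y"
          using False eps \<open>\<omega> \<in> \<Omega>\<close> by (intro bound) (auto simp: Z_def)
        ultimately show ?thesis using False by simp
      qed
    qed
    then have "(\<Sum>\<omega>\<in>\<Omega>. \<Sum>n\<in>N \<omega>. x \<omega> n j)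
      \<le> (\<Sum>\<omega>\<in>\<Omega>. (e j)\<^sup>2 - (c j)\<^sup>2 + (6 * \<epsilon> + (if \<omega> \<in> Z then 30 else 0)) * y)"
      by (rule sum_mono)
    also have "\<dots> = real (card \<Omega>) * ((e j)\<^sup>2 - (c j)\<^sup>2 + 6 * \<epsilon> * y) + 30 * real (card Z) * y"
    proof -
      have "(\<Sum>\<omega>\<in>\<Omega>. if \<omega> \<in> Z then 30 else 0) = 30 * real (card Z)"
      proof -
        have "\<Omega> \<inter> {\<omega>. \<omega> \<in> Z} = Z" by (auto simp: Z_def)
        then show ?thesis using \<Omega>(1) by (simp add: sum.If_cases)
      qed
      moreover have "(e j)\<^sup>2 - (c j)\<^sup>2 + (6 * \<epsilon> + r) * y
        = ((e j)\<^sup>2 - (c j)\<^sup>2 + 6 * \<epsilon> * y) + r * y" for r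
        by (simp add: distrib_right)
      ultimately show ?thesis
        by (simp only: sum.distrib sum_distrib_right[symmetric] sum_constant)
          (simp add: algebra_simps)
    qed
    also have "\<dots> \<le> real (card \<Omega>) * ((e j)\<^sup>2 - (c j)\<^sup>2 + 6 * \<epsilon> * y) + 30 * (5 * \<epsilon> * real (card \<Omega>)) * y"
      using Z y by (intro add_left_mono mult_right_mono mult_left_mono) auto
    also have "\<dots> = real (card \<Omega>) * ((e j)\<^sup>2 - (c j)\<^sup>2 + 156 * \<epsilon> * y)"
      by (simp add: algebra_simps)
    finally show ?thesis by (simp add: y_def)
  qed
  have "0 \<le> (\<Sum>\<omega>\<in>\<Omega>. \<Sum>n\<in>N \<omega>. \<Sum>j\<in>X. x \<omega> n j)"
    by (rule sum_nonneg, rule sum_nonneg, rule swap)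
  also have "\<dots> = (\<Sum>\<omega>\<in>\<Omega>. \<Sum>j\<in>X. \<Sum>n\<in>N \<omega>. x \<omega> n j)"
    by (intro sum.cong refl sum.swap)
  also have "\<dots> = (\<Sum>j\<in>X. \<Sum>\<omega>\<in>\<Omega>. \<Sum>n\<in>N \<omega>. x \<omega> n j)" by (rule sum.swap)
  also have "\<dots> \<le> (\<Sum>j\<in>X. real (card \<Omega>) * ((e j)\<^sup>2 - (c j)\<^sup>2 + 156 * \<epsilon> * ((c j)\<^sup>2 + (e j)\<^sup>2)))"
    using client by (rule sum_mono)
  also have "\<dots> = real (card \<Omega>) * (kmeans_cost d X T - kmeans_cost d X S
    + 156 * \<epsilon> * (kmeans_cost d X S + kmeans_cost d X T))"
    by (simp add: kmeans_cost_def c_def e_def sum_distrib_left sum.distrib sum_subtractf algebra_simps)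
  finally have "0 \<le> kmeans_cost d X T - kmeans_cost d X S
    + 156 * \<epsilon> * (kmeans_cost d X S + kmeans_cost d X T)"
    using \<Omega> by (simp add: zero_le_mult_iff card_gt_0_iff)
  then show ?thesis by simp
qed

theorem theorem4:
  shows "\<exists>c \<epsilon>\<^sub>0 :: real. c > 0 \<and> 0 < \<epsilon>\<^sub>0 \<and> \<epsilon>\<^sub>0 < 1 \<and>
    (\<forall>(\<epsilon>::real) (d::nat) (X::(nat \<Rightarrow> real) set) (C::(nat \<Rightarrow> real) set) (k::nat)
       (S::(nat \<Rightarrow> real) set) (Opt::(nat \<Rightarrow> real) set).
       0 < \<epsilon> \<longrightarrow> \<epsilon> < \<epsilon>\<^sub>0 \<longrightarrow> 2 \<le> d \<longrightarrow>
       finite X \<longrightarrow> X \<subseteq> topspace (Euclidean_space d) \<longrightarrow>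
       finite C \<longrightarrow> C \<subseteq> topspace (Euclidean_space d) \<longrightarrow>
       1 \<le> k \<longrightarrow> k \<le> card C \<longrightarrow>
       S \<subseteq> C \<longrightarrow> card S = k \<longrightarrow> swap_locally_optimal d X C (swap_size d \<epsilon>) S \<longrightarrow>
       Opt \<subseteq> C \<longrightarrow> card Opt = k \<longrightarrow>
       (\<forall>T. T \<subseteq> C \<longrightarrow> card T = k \<longrightarrow> kmeans_cost d X Opt \<le> kmeans_cost d X T) \<longrightarrow>
       kmeans_cost d X S \<le> (1 + c * \<epsilon>) * kmeans_cost d X Opt)"
proof (rule exI[of _ 624], rule exI[of _ "1 / 312"], intro conjI allI impI)
  fix \<epsilon> :: real and d :: nat and X C :: "(nat \<Rightarrow> real) set" and k :: nat
    and S Opt :: "(nat \<Rightarrow> real) set"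
  assume eps: "0 < \<epsilon>" "\<epsilon> < 1 / 312" and d: "2 \<le> d"
    and C: "finite C" "C \<subseteq> topspace (Euclidean_space d)" and k: "1 \<le> k"
    and S: "S \<subseteq> C" "card S = k" and loc: "swap_locally_optimal d X C (swap_size d \<epsilon>) S"
    and Opt: "Opt \<subseteq> C" "card Opt = k"
  define s t where "s = kmeans_cost d X S" and "t = kmeans_cost d X Opt"
  have "S \<noteq> {}" using S k by auto
  then have le: "s \<le> t + 156 * \<epsilon> * (s + t)"
    unfolding s_def t_def using eps d C S Opt loc finite_subset[OF _ C(1)]
    by (intro local_optimum_cost_le[where C = C]) auto
  have t: "0 \<le> t" by (simp add: t_def kmeans_cost_def sum_nonneg)
  \<comment> \<open>The bound \<open>\<epsilon> < 1 / 312\<close> gives \<open>z < 1 / 2\<close>,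
    where \<open>(1 + z) / (1 - z) \<le> 1 + 4 * z\<close>; the constant 624 is
    \<open>4 * 156\<close>.\<close>
  define z where "z = 156 * \<epsilon>"
  have z: "0 < z" "z < 1 / 2" using eps by (auto simp: z_def)
  have "(1 - z) * s \<le> (1 + z) * t" using le by (simp add: z_def algebra_simps)
  also have "\<dots> \<le> ((1 - z) * (1 + 4 * z)) * t"
  proof -
    have "z * z \<le> 1 / 2 * z" using z by (intro mult_right_mono) auto
    then have "1 + z \<le> (1 - z) * (1 + 4 * z)" by (simp add: algebra_simps)
    then show ?thesis using t by (rule mult_right_mono)
  qed
  finally have "(1 - z) * s \<le> (1 - z) * ((1 + 4 * z) * t)" by (simp add: mult.assoc)
  then have "s \<le> (1 + 4 * z) * t" using z by simp
  then show "kmeans_cost d X S \<le> (1 + 624 * \<epsilon>) * kmeans_cost d X Opt"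
    by (simp add: s_def t_def z_def)
qed simp_all

end
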